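(* Let $p$ be an odd prime and let $G$ be a finite abelian $p$-group. If $|G|\geq p^3$ and $G$ is not cyclic, then there exists a proper Cayley digraph $\Gamma$ on $G$ with Cayley index $p$ such that $\mathrm{Aut}(\Gamma)$ contains a nonabelian regular subgroup.
   Context: All digraphs and groups are finite. A digraph $\Gamma$ has a vertex set $\mathrm{V}(\Gamma)$ and an arc set $\mathrm{A}(\Gamma)$ consisting of ordered pairs of distinct vertices (no loops). $\Gamma$ is a graph if $(v,u)$ is an arc whenever $(u,v)$ is; otherwise $\Gamma$ is a proper digraph. $\mathrm{Aut}(\Gamma)$ is the group of permutations of $\mathrm{V}(\Gamma)$ preserving $\mathrm{A}(\Gamma)$. For a group $G$ and $S\subseteq G$ not containing the identity, the Cayley digraph $\mathrm{Cay}(G,S)$ has vertex set $G$ and arcs $(u,v)$ whenever $vu^{-1}\in S$. The group $G$ embeds in $\mathrm{Aut}(\mathrm{Cay}(G,S))$ via its right regular representation (right multiplication), and the Cayley index of $\mathrm{Cay}(G,S)$ is the index $|\mathrm{Aut}(\mathrm{Cay}(G,S)):G|$. A subgroup of $\mathrm{Aut}(\Gamma)$ is regular if it acts regularly on $\mathrm{V}(\Gamma)$. *)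

theory Defs
  imports
    "HOL-Algebra.Group_Action"
    "HOL-Algebra.Elementary_Groups"
    "HOL-Computational_Algebra.Primes"
    "Graph_Theory.Pair_Digraph"
begin

definition proper_digraph :: "'a pair_pre_digraph \<Rightarrow> bool" where
  "proper_digraph \<Gamma> \<longleftrightarrow> pair_digraph \<Gamma> \<and> \<not> symmetric (with_proj \<Gamma>)"

text \<open>As in \<^const>\<open>BijGroup\<close>, a permutation of the vertex set is represented by a function that is
  extensional on it, so that distinct functions are distinct permutations.\<close>

definition digraph_automorphisms :: "'a pair_pre_digraph \<Rightarrow> ('a \<Rightarrow> 'a) set" where
  "digraph_automorphisms \<Gamma> =
    {f \<in> Bij (pverts \<Gamma>).
      \<forall>u \<in> pverts \<Gamma>. \<forall>v \<in> pverts \<Gamma>. (u, v) \<in> parcs \<Gamma> \<longleftrightarrow> (f u, f v) \<in> parcs \<Gamma>}"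

definition Aut_digraph :: "'a pair_pre_digraph \<Rightarrow> ('a \<Rightarrow> 'a) monoid" where
  "Aut_digraph \<Gamma> = (BijGroup (pverts \<Gamma>))\<lparr>carrier := digraph_automorphisms \<Gamma>\<rparr>"

definition regular_subgroup :: "('a \<Rightarrow> 'a) set \<Rightarrow> 'a pair_pre_digraph \<Rightarrow> bool" where
  "regular_subgroup R \<Gamma> \<longleftrightarrow>
    subgroup R (Aut_digraph \<Gamma>) \<and>
    transitive_action ((Aut_digraph \<Gamma>)\<lparr>carrier := R\<rparr>) (pverts \<Gamma>) (\<lambda>f. f) \<and>
    (\<forall>v \<in> pverts \<Gamma>. stabilizer ((Aut_digraph \<Gamma>)\<lparr>carrier := R\<rparr>) (\<lambda>f. f) v = {\<one>\<^bsub>Aut_digraph \<Gamma>\<^esub>})"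

definition Cay :: "('a, 'b) monoid_scheme \<Rightarrow> 'a set \<Rightarrow> 'a pair_pre_digraph" where
  "Cay G S = \<lparr>pverts = carrier G,
     parcs = {(u, v). u \<in> carrier G \<and> v \<in> carrier G \<and> v \<otimes>\<^bsub>G\<^esub> inv\<^bsub>G\<^esub> u \<in> S}\<rparr>"

definition right_regular :: "('a, 'b) monoid_scheme \<Rightarrow> ('a \<Rightarrow> 'a) set" where
  "right_regular G = (\<lambda>g. \<lambda>x \<in> carrier G. x \<otimes>\<^bsub>G\<^esub> g) ` carrier G"

definition Cayley_index :: "('a, 'b) monoid_scheme \<Rightarrow> 'a set \<Rightarrow> nat" where
  "Cayley_index G S = card (rcosets\<^bsub>Aut_digraph (Cay G S)\<^esub> (right_regular G))"

lemma (in group) pair_digraph_Cay: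
  assumes "finite (carrier G)" "\<one> \<notin> S"
  shows "pair_digraph (Cay G S)"
proof
  show "finite (parcs (Cay G S))"
    by (rule finite_subset[of _ "carrier G \<times> carrier G"]) (auto simp: Cay_def assms)
qed (use assms in \<open>auto simp: Cay_def\<close>)

lemma group_Aut_digraph: "group (Aut_digraph \<Gamma>)"
proof -
  let ?V = "pverts \<Gamma>"
  interpret B: group "BijGroup ?V" by (rule group_BijGroup)
  have "subgroup (digraph_automorphisms \<Gamma>) (BijGroup ?V)"
  proof (rule B.subgroupI)
    show "digraph_automorphisms \<Gamma> \<subseteq> carrier (BijGroup ?V)"
      by (auto simp: digraph_automorphisms_def BijGroup_def)
    have "(\<lambda>x\<in>?V. x) \<in> digraph_automorphisms \<Gamma>"
      by (simp add: digraph_automorphisms_def id_Bij)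
    then show "digraph_automorphisms \<Gamma> \<noteq> {}" by blast
  next
    fix f assume f: "f \<in> digraph_automorphisms \<Gamma>"
    then have fB: "f \<in> Bij ?V" by (simp add: digraph_automorphisms_def)
    then have eq: "f (inv_into ?V f u) = u" if "u \<in> ?V" for u
      using that by (auto simp: Bij_def bij_betw_def f_inv_into_f)
    have "(\<lambda>x\<in>?V. inv_into ?V f x) \<in> digraph_automorphisms \<Gamma>"
      using f eq Bij_inv_into_mem[OF fB] restrict_inv_into_Bij[OF fB]
      by (auto simp: digraph_automorphisms_def)
    then show "inv\<^bsub>BijGroup ?V\<^esub> f \<in> digraph_automorphisms \<Gamma>"
      by (simp add: inv_BijGroup fB)
  next
    fix f g assume fg: "f \<in> digraph_automorphisms \<Gamma>" "g \<in> digraph_automorphisms \<Gamma>"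
    then have B: "f \<in> Bij ?V" "g \<in> Bij ?V" by (auto simp: digraph_automorphisms_def)
    have "g u \<in> ?V" if "u \<in> ?V" for u using B(2) that Bij_imp_funcset by blast
    then have "compose ?V f g \<in> digraph_automorphisms \<Gamma>"
      using fg compose_Bij[OF B] by (auto simp: digraph_automorphisms_def compose_def)
    then show "f \<otimes>\<^bsub>BijGroup ?V\<^esub> g \<in> digraph_automorphisms \<Gamma>"
      using B by (simp add: BijGroup_def)
  qed
  then show ?thesis unfolding Aut_digraph_def by (rule B.subgroup_imp_group)
qed

lemma (in group) subgroup_right_regular: "subgroup (right_regular G) (Aut_digraph (Cay G S))"
proof -
  define \<rho> where "\<rho> g = (\<lambda>x\<in>carrier G. x \<otimes> g)" for g
  have R: "right_regular G = \<rho> ` carrier G"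
    by (simp add: right_regular_def \<rho>_def)
  have V: "pverts (Cay G S) = carrier G" by (simp add: Cay_def)
  have Bij: "\<rho> g \<in> Bij (carrier G)" if "g \<in> carrier G" for g
  proof -
    have "bij_betw (\<rho> g) (carrier G) (carrier G)"
      by (rule bij_betw_byWitness[where f' = "\<lambda>x. x \<otimes> inv g"]) (auto simp: \<rho>_def that m_assoc)
    then show ?thesis by (simp add: Bij_def \<rho>_def)
  qed
  have quot: "(v \<otimes> g) \<otimes> inv (u \<otimes> g) = v \<otimes> inv u"
    if "g \<in> carrier G" "u \<in> carrier G" "v \<in> carrier G" for g u v
  proof -
    have "g \<otimes> (inv g \<otimes> inv u) = inv u"
      using that by (simp add: m_assoc[symmetric])
    then show ?thesis
      using that by (simp add: inv_mult_group m_assoc)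
  qed
  have aut: "\<rho> g \<in> carrier (Aut_digraph (Cay G S))" if "g \<in> carrier G" for g
    using Bij[OF that] that quot
    by (auto simp: Aut_digraph_def digraph_automorphisms_def Cay_def \<rho>_def)
  have mult: "\<rho> g \<otimes>\<^bsub>Aut_digraph (Cay G S)\<^esub> \<rho> h = \<rho> (h \<otimes> g)"
    if "g \<in> carrier G" "h \<in> carrier G" for g h
    using that Bij
    by (auto simp: Aut_digraph_def V BijGroup_def compose_def \<rho>_def m_assoc fun_eq_iff)
  have one: "\<rho> \<one> = \<one>\<^bsub>Aut_digraph (Cay G S)\<^esub>"
    by (auto simp: Aut_digraph_def V BijGroup_def \<rho>_def fun_eq_iff)
  interpret A: group "Aut_digraph (Cay G S)" by (rule group_Aut_digraph)
  have inv: "inv\<^bsub>Aut_digraph (Cay G S)\<^esub> \<rho> g = \<rho> (inv g)" if "g \<in> carrier G" for g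
    using that by (intro A.inv_equality) (auto simp: mult one aut)
  show ?thesis
    unfolding R by (rule A.subgroupI) (auto simp: aut inv mult)
qed

end

theory Submission
  imports Defs "HOL-Algebra.Multiplicative_Group" "HOL-Number_Theory.Cong"
begin

text \<open>
  Choose homomorphisms \<open>f, h\<close> from \<open>G\<close> onto the integers modulo \<open>p\<close> with \<open>f x = 1\<close>, \<open>f u = 0\<close>,
  \<open>h x = 0\<close>, \<open>h u = 1\<close>, let \<open>N\<close> be the intersection of their kernels, and choose independent
  \<open>y, z\<close> of order \<open>p\<close> with \<open>z \<in> N\<close>. If some element of order \<open>p\<close> is not a \<open>p\<close>-th power, take it
  for \<open>u = y\<close>; otherwise \<open>y \<in> N\<close>. Then \<open>g \<mapsto> g y\<^bsup>f g\<^esup> z\<^bsup>h g\<^esup>\<close> is an automorphism \<open>\<alpha>\<close> of \<open>G\<close> of order \<open>p\<close>.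
  The connection set \<open>S\<close> consists of generators \<open>\<tau> 0 = z, \<tau> 1, \<dots>, \<tau> m\<close> of \<open>N\<close>, each outside the
  subgroup generated by its predecessors, of the \<open>\<langle>z\<rangle>\<close>-cosets of \<open>u, u \<tau> 1, u \<tau> 1 \<tau> 2, \<dots>\<close>, and of the
  \<open>\<alpha>\<close>-orbits of \<open>x\<close> and \<open>x u\<close>.

  The arcs inside \<open>S\<close> distinguish these three parts, and the chain of cosets distinguishes the
  \<open>\<tau> i\<close> from one another. Hence every digraph automorphism commutes with translations by \<open>N\<close>, and one
  that fixes \<open>1\<close> and \<open>x\<close> is trivial. So the stabilizer of \<open>1\<close> is generated by \<open>\<alpha>\<close>, and the maps
  \<open>v \<mapsto> \<alpha>\<^bsup>f g\<^esup>(v) g\<close> form a nonabelian regular subgroup.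
\<close>

subsection \<open>Preliminaries on finite abelian groups\<close>

text \<open>The stabilizer of \<one> has to be exactly <\<alpha>>, so \<open>S\<close> must be
  invariant under \<alpha> and otherwise rigid. Since \<alpha> sends u to u z, invariance forces
  whole <z>-cosets into \<open>S\<close>. An automorphism that fixes x could still slide u along its
  coset; the arc from x to x u prevents this, because \<open>X\<close> meets each of the cosets x
  <z> and x u <z> in a single point. The case split comes from y and z having to be independent with
  z in N. If y can serve as u, then h y = 1, \<alpha> sends x to x u and the two orbits in
  \<open>X\<close> coincide; |G| >= p^3 leaves room for z in N. Otherwise all elements of order p
  are p-th powers, hence killed by f and h, and both y and z are found in N because a noncyclic
  abelian p-group has more than p solutions of g^p = 1. Oddness of p enters in three ways: p divides
  (p choose 2), so \<alpha> has order p; 2 differs from 0 and 1 modulo p, which rules out products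
  inside \<open>S\<close>; and a square lies in a subgroup only if its root does, which keeps the
  chain of generators strict.\<close>

lemma (in group) pow_cong_exponent:
  assumes "a \<in> carrier G" "a [^] (p::nat) = \<one>" "[i = j] (mod p)"
  shows "a [^] (i::nat) = a [^] j"
proof -
  have *: "a [^] k = a [^] (k mod p)" for k :: nat
  proof -
    have "a [^] k = a [^] (p * (k div p) + k mod p)" by simp
    also have "\<dots> = (a [^] p) [^] (k div p) \<otimes> a [^] (k mod p)"
      by (simp only: nat_pow_mult[symmetric] nat_pow_pow assms(1))
    finally show ?thesis using assms(1,2) by simp
  qed
  show ?thesis using *[of i] *[of j] assms(3) by (simp add: cong_def)
qed

lemma (in group) pow_dvd_exponent:
  "\<lbrakk>a \<in> carrier G; a [^] (p::nat) = \<one>; p dvd k\<rbrakk> \<Longrightarrow> a [^] (k::nat) = \<one>"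
  using pow_cong_exponent[of a p k 0] by (simp add: cong_0_iff)

lemma (in group) subgroup_nat_pow_closed:
  "subgroup H G \<Longrightarrow> a \<in> H \<Longrightarrow> a [^] (k::nat) \<in> H"
  by (metis int_pow_int subgroup_int_pow_closed)

text \<open>In a group of order 2 r + 1 every element is a power of its own square:
  \<open>a = (a \<otimes> a) [^] (r + 1)\<close>.\<close>

lemma (in group) odd_order_root_in_subgroup:
  assumes "odd (order G)" "subgroup H G" "a \<in> carrier G" "a \<otimes> a \<in> H"
  shows "a \<in> H"
proof -
  obtain r where r: "order G = 2 * r + 1" using assms(1) by (auto elim: oddE)
  have sq: "a \<otimes> a = a [^] (2::nat)"
    using assms(3) by (simp add: numeral_2_eq_2)
  have "a = a [^] order G \<otimes> a"
    using assms(3) pow_order_eq_1 by simp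
  also have "\<dots> = a [^] (order G + 1)" using assms(3) by simp
  also have "\<dots> = a [^] (2 * (r + 1))" by (simp add: r)
  also have "\<dots> = (a \<otimes> a) [^] (r + 1)"
    by (simp only: sq nat_pow_pow assms(3))
  also have "\<dots> \<in> H" using assms(2,4) by (rule subgroup_nat_pow_closed)
  finally show ?thesis .
qed

text \<open>Makes the quadratic exponent in \<open>\<alpha>\<close> vanish at multiples of p. It
  fails for p = 2, since (2 choose 2) = 1.\<close>

lemma odd_dvd_choose_two:
  assumes "odd (p::nat)" "p dvd k"
  shows "p dvd (k choose 2)"
proof -
  have "even (k * (k - 1))" by (cases k) auto
  then have "2 * (k choose 2) = k * (k - 1)" by (simp only: choose_two dvd_mult_div_cancel)
  then have "p dvd 2 * (k choose 2)" using assms(2) by simp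
  moreover have "coprime p 2" using assms(1) by simp
  ultimately show ?thesis using coprime_dvd_mult_right_iff by blast
qed

lemma choose_two_add: "(k + l) choose 2 = (k choose 2) + (l choose 2) + k * l" for k l :: nat
proof (induction l)
  case (Suc l)
  then show ?case by (simp add: numeral_2_eq_2)
qed (simp add: numeral_2_eq_2)

lemma (in group) subgroup_cancel_left:
  "\<lbrakk>subgroup H G; a \<in> H; b \<in> carrier G; a \<otimes> b \<in> H\<rbrakk> \<Longrightarrow> b \<in> H"
  by (metis inv_solve_left subgroup.m_closed subgroup.m_inv_closed subgroup.mem_carrier)

lemma (in group) subgroup_cancel_right:
  "\<lbrakk>subgroup H G; a \<in> H; b \<in> carrier G; b \<otimes> a \<in> H\<rbrakk> \<Longrightarrow> b \<in> H"
  by (metis inv_solve_right subgroup.m_closed subgroup.m_inv_closed subgroup.mem_carrier)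

section \<open>Homomorphisms to the integers modulo p\<close>

definition (in group) functional_mod :: "nat \<Rightarrow> ('a \<Rightarrow> nat) \<Rightarrow> bool" where
  "functional_mod p f \<longleftrightarrow>
    (\<forall>a\<in>carrier G. \<forall>b\<in>carrier G. f (a \<otimes> b) = (f a + f b) mod p)"

lemma (in group) functional_mod_mult:
  "\<lbrakk>functional_mod p f; a \<in> carrier G; b \<in> carrier G\<rbrakk> \<Longrightarrow> f (a \<otimes> b) = (f a + f b) mod p"
  by (simp add: functional_mod_def)

text \<open>The range bound is built into the definition: writing \<open>a\<close> as
  \<open>a \<otimes> \<one>\<close> exhibits every value as a remainder modulo p. The only residue
  equal to its own double is 0.\<close>

lemma (in group)
  assumes f: "functional_mod p f"
    and p: "0 < p"
  shows functional_mod_less: "a \<in> carrier G \<Longrightarrow> f a < p"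
    and functional_mod_one: "f \<one> = 0"
    and functional_mod_pow: "a \<in> carrier G \<Longrightarrow> f (a [^] (k::nat)) = (k * f a) mod p"
    and functional_mod_inv: "\<lbrakk>a \<in> carrier G; f a = 0\<rbrakk> \<Longrightarrow> f (inv a) = 0"
proof -
  note mult = functional_mod_mult[OF f]
  show less: "f a < p" if "a \<in> carrier G" for a
    using mult[of a \<one>] that p by (metis mod_less_divisor one_closed r_one)
  have "f \<one> = (f \<one> + f \<one>) mod p" using mult[of \<one> \<one>] by simp
  then show one: "f \<one> = 0" using less[of \<one>] by (auto simp: mod_if split: if_splits)
  show "f (a [^] (k::nat)) = (k * f a) mod p" if "a \<in> carrier G" for a k
    by (induction k) (auto simp: one mult that mod_simps algebra_simps)
  show "f (inv a) = 0" if "a \<in> carrier G" "f a = 0" for a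
    using mult[of a "inv a"] that one less[of "inv a"] by simp
qed

lemma (in group) functional_mod_eqD:
  assumes f: "functional_mod p f"
    and p: "0 < p" and ab: "a \<in> carrier G" "b \<in> carrier G" "f a = f b"
  shows "f (a \<otimes> inv b) = 0"
proof -
  have "f a = (f (a \<otimes> inv b) + f b) mod p"
    using functional_mod_mult[OF f, of "a \<otimes> inv b" b] ab by (simp add: m_assoc)
  then show ?thesis
    using ab functional_mod_less[OF f p, of b] functional_mod_less[OF f p, of "a \<otimes> inv b"]
    by (auto simp: mod_if split: if_splits)
qed

lemma prime_not_dvd_inverse:
  fixes p j :: nat
  assumes "prime p" "\<not> p dvd j"
  obtains i q :: nat where "j * i = 1 + p * q"
proof -
  have "coprime j p" using assms prime_imp_coprime_nat coprime_commute by blast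
  then obtain i where "[j * i = 1] (mod p)" using cong_solve_coprime_nat by auto
  moreover have "1 < p" using assms(1) prime_gt_1_nat by blast
  ultimately have "(j * i) mod p = 1" by (simp add: cong_def)
  then have "j * i = 1 + p * ((j * i) div p)" by (metis add.commute mult_div_mod_eq)
  then show thesis using that by blast
qed

text \<open>All p-th powers die modulo \<open>K\<close>, so an exponent prime to p can be undone by
  its inverse modulo p.\<close>

lemma (in comm_group) pow_in_subgroup_cancel:
  assumes "prime p" "subgroup K G" "\<And>a. a \<in> carrier G \<Longrightarrow> a [^] p \<in> K"
    and g: "g \<in> carrier G" and j: "\<not> p dvd j" "g [^] (j::nat) \<in> K"
  shows "g \<in> K"
proof -
  obtain i q where iq: "j * i = 1 + p * q" using prime_not_dvd_inverse assms(1) j(1) by blast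
  have "(g [^] j) [^] i = g \<otimes> (g [^] q) [^] p"
    using g by (simp add: nat_pow_pow iq mult.commute[of q] nat_pow_mult[symmetric] m_comm)
  moreover have "(g [^] j) [^] i \<in> K" by (rule subgroup_nat_pow_closed[OF assms(2) j(2)])
  ultimately have "g \<otimes> (g [^] q) [^] p \<in> K" by simp
  moreover have "(g [^] q) [^] p \<in> K" using assms(3) g by simp
  ultimately show ?thesis using subgroup_cancel_right[OF assms(2) _ g] by blast
qed

lemma (in comm_group) subgroup_mult_powers:
  assumes "finite (carrier G)" "subgroup K G" "g \<in> carrier G"
  shows "subgroup {k \<otimes> g [^] (j::nat) | k j. k \<in> K} G" (is "subgroup ?K' G")
proof (rule subgroupI)
  have Kc: "k \<in> carrier G" if "k \<in> K" for k using assms(2) that subgroup.mem_carrier by metis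
  show "?K' \<subseteq> carrier G" using assms Kc by auto
  show "?K' \<noteq> {}" using subgroup.one_closed[OF assms(2)] by blast
  show "inv a \<in> ?K'" if a: "a \<in> ?K'" for a
  proof -
    obtain k and j :: nat where a: "a = k \<otimes> g [^] j" "k \<in> K" using a by blast
    \<comment> \<open>With natural exponents, \<open>(order G - 1) * j\<close> takes the place of
      \<open>- j\<close>.\<close>
    have "(order G - 1) * j + j = order G * j"
      using order_gt_0_iff_finite assms(1) by (cases "order G") auto
    then have "g [^] ((order G - 1) * j) \<otimes> g [^] j = (g [^] order G) [^] j"
      using assms(3) by (simp only: nat_pow_mult nat_pow_pow)
    also have "\<dots> = \<one>" using assms pow_order_eq_1 by simp
    finally have "inv (g [^] j) = g [^] ((order G - 1) * j)" using assms(3) by (intro inv_equality) auto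
    then have "inv a = inv k \<otimes> g [^] ((order G - 1) * j)"
      using a assms(3) Kc by (simp add: inv_mult)
    then show ?thesis using a(2) subgroup.m_inv_closed[OF assms(2)] by blast
  qed
  show "a \<otimes> b \<in> ?K'" if a: "a \<in> ?K'" and b: "b \<in> ?K'" for a b
  proof -
    obtain k and j :: nat where a: "a = k \<otimes> g [^] j" "k \<in> K" using a by blast
    obtain k' and j' :: nat where b: "b = k' \<otimes> g [^] j'" "k' \<in> K" using b by blast
    have "a \<otimes> b = (k \<otimes> k') \<otimes> g [^] (j + j')"
      using a b assms(3) Kc by (simp add: m_ac nat_pow_mult[symmetric])
    moreover have "k \<otimes> k' \<in> K" using a b subgroup.m_closed[OF assms(2)] by blast
    ultimately show ?thesis by blast
  qed
qed

text \<open>Separates a vector from a subspace of the vector space G/H over the field with p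
  elements, without a basis: a subgroup \<open>K\<close> maximal among those containing
  \<open>H\<close> and avoiding \<open>w\<close> has a quotient of order p generated by the class of
  \<open>w\<close>, and the exponent of \<open>w\<close> is the functional.\<close>

lemma (in comm_group) exists_functional_mod_prime:
  assumes fin: "finite (carrier G)" and p: "prime p"
    and H: "subgroup H G" and pH: "\<And>a. a \<in> carrier G \<Longrightarrow> a [^] p \<in> H"
    and w: "w \<in> carrier G" "w \<notin> H"
  obtains f :: "'a \<Rightarrow> nat"
  where "functional_mod p f" "f w = 1" "\<And>a. a \<in> H \<Longrightarrow> f a = 0"
proof -
  define Ks where "Ks = {K. subgroup K G \<and> H \<subseteq> K \<and> w \<notin> K}"
  have "finite Ks"
    by (rule finite_subset[of _ "Pow (carrier G)"]) (use fin in \<open>auto simp: Ks_def dest: subgroup.subset\<close>)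
  moreover have "H \<in> Ks" using H w by (simp add: Ks_def)
  ultimately obtain K where K: "K \<in> Ks" and max: "\<And>K'. K' \<in> Ks \<Longrightarrow> K \<subseteq> K' \<Longrightarrow> K' = K"
    using finite_has_maximal[of Ks] by (metis empty_iff)
  have sK: "subgroup K G" and HK: "H \<subseteq> K" and wK: "w \<notin> K" using K by (auto simp: Ks_def)
  have pK: "a [^] p \<in> K" if "a \<in> carrier G" for a using pH HK that by blast
  have Kc: "k \<in> carrier G" if "k \<in> K" for k using sK that subgroup.mem_carrier by metis
  have p1: "1 < p" using p prime_gt_1_nat by blast
  have reduce: "\<exists>k\<in>K. w [^] i = k \<otimes> w [^] (i mod p)" for i :: nat
  proof
    have "w [^] i = w [^] ((i div p) * p + i mod p)" by simp
    then show "w [^] i = (w [^] (i div p)) [^] p \<otimes> w [^] (i mod p)"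
      using w by (simp only: nat_pow_mult[symmetric] nat_pow_pow)
    show "(w [^] (i div p)) [^] p \<in> K" using pK w by simp
  qed
  have ex0: "\<exists>i::nat. \<exists>k\<in>K. g = k \<otimes> w [^] i" if g: "g \<in> carrier G" for g
  proof (cases "g \<in> K")
    case True
    then have "g = g \<otimes> w [^] (0::nat)" using g by simp
    then show ?thesis using True by blast
  next
    case False
    \<comment> \<open>As \<open>g\<close> is outside \<open>K\<close>, this properly extends
      \<open>K\<close>, so by maximality it contains \<open>w\<close>. The relation
      \<open>w = k \<otimes> g [^] j\<close> can be solved for \<open>g\<close> modulo
      \<open>K\<close>, since p dividing j would put \<open>w\<close> into \<open>K\<close>.\<close>
    define K' where "K' = {k \<otimes> g [^] (j::nat) | k j. k \<in> K}"
    have sK': "subgroup K' G" unfolding K'_def by (rule subgroup_mult_powers[OF fin sK g])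
    have "k = k \<otimes> g [^] (0::nat)" if "k \<in> K" for k using Kc that by simp
    then have KK': "K \<subseteq> K'" unfolding K'_def by blast
    have "g = \<one> \<otimes> g [^] (1::nat)" using g by simp
    then have "g \<in> K'" unfolding K'_def using subgroup.one_closed[OF sK] by blast
    then have "K' \<noteq> K" using False by blast
    then have "w \<in> K'" using max[of K'] KK' sK' HK by (auto simp: Ks_def)
    then obtain k and j :: nat where kj: "k \<in> K" "w = k \<otimes> g [^] j" unfolding K'_def by blast
    have "\<not> p dvd j"
    proof
      assume "p dvd j"
      then obtain l where "j = l * p" by (metis dvd_def mult.commute)
      then have "g [^] j = (g [^] l) [^] p" using g by (simp add: nat_pow_pow)
      then have "w \<in> K" using kj pK g subgroup.m_closed[OF sK] by simp
      then show False using wK by blast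
    qed
    then obtain i q where iq: "j * i = 1 + p * q" using prime_not_dvd_inverse p by blast
    have "g [^] (j * i) = g \<otimes> (g [^] q) [^] p"
      using g by (simp add: nat_pow_pow iq mult.commute[of q] nat_pow_mult[symmetric] m_comm)
    then have wi: "w [^] i = (k [^] i \<otimes> (g [^] q) [^] p) \<otimes> g"
      using kj Kc g by (simp add: nat_pow_distrib nat_pow_pow m_ac)
    define l where "l = k [^] i \<otimes> (g [^] q) [^] p"
    have l: "l \<in> K"
      unfolding l_def
      by (rule subgroup.m_closed[OF sK subgroup_nat_pow_closed[OF sK kj(1)] pK[OF nat_pow_closed[OF g]]])
    then have "g = inv l \<otimes> w [^] i"
      using wi g Kc by (simp add: l_def[symmetric] m_assoc[symmetric])
    then show ?thesis using subgroup.m_inv_closed[OF sK l] by blast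
  qed
  have ex: "\<exists>i<p. \<exists>k\<in>K. g = k \<otimes> w [^] i" if g: "g \<in> carrier G" for g
  proof -
    obtain i k where ik: "k \<in> K" "g = k \<otimes> w [^] (i::nat)" using ex0[OF g] by blast
    obtain l where l: "l \<in> K" "w [^] i = l \<otimes> w [^] (i mod p)" using reduce by blast
    have "g = (k \<otimes> l) \<otimes> w [^] (i mod p)" unfolding ik(2) l(2) using ik l Kc w by (simp add: m_assoc)
    moreover have "k \<otimes> l \<in> K" using ik l subgroup.m_closed[OF sK] by blast
    moreover have "i mod p < p" using p1 by simp
    ultimately show ?thesis by blast
  qed
  have le: "i = j" if "k \<in> K" "l \<in> K" "k \<otimes> w [^] i = l \<otimes> w [^] j" "j < p" "i \<le> j" for k l and i j :: nat
  proof (rule ccontr)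
    assume "i \<noteq> j"
    define d where "d = j - i"
    have j: "j = d + i" and d: "0 < d" "d < p" using that \<open>i \<noteq> j\<close> by (auto simp: d_def)
    have "k \<otimes> w [^] i = (l \<otimes> w [^] d) \<otimes> w [^] i"
      using that w Kc by (simp add: j nat_pow_mult[symmetric] m_assoc)
    then have "k = l \<otimes> w [^] d" using that w Kc by simp
    then have "w [^] d = inv l \<otimes> k" using that w Kc by (simp add: m_assoc[symmetric])
    then have "w [^] d \<in> K" using that subgroup.m_closed[OF sK] subgroup.m_inv_closed[OF sK] by simp
    moreover have "\<not> p dvd d" using d by (simp add: nat_dvd_not_less)
    ultimately have "w \<in> K" using pow_in_subgroup_cancel[OF p sK pK w(1)] by blast
    then show False using wK by blast
  qed
  have uniq: "i = j" if "k \<in> K" "l \<in> K" "k \<otimes> w [^] i = l \<otimes> w [^] j" "i < p" "j < p" for k l and i j :: nat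
    using le[of k l i j] le[of l k j i] that by (metis nat_le_linear)
  define f where "f g = (THE i. i < p \<and> (\<exists>k\<in>K. g = k \<otimes> w [^] i))" for g
  have f_eq: "f g = i" if "i < p" "k \<in> K" "g = k \<otimes> w [^] i" for g k i
    unfolding f_def by (rule the_equality) (use that uniq in blast)+
  have f_spec: "f g < p \<and> (\<exists>k\<in>K. g = k \<otimes> w [^] f g)" if g: "g \<in> carrier G" for g
  proof -
    obtain i k where i: "i < p" "k \<in> K" "g = k \<otimes> w [^] i" using ex[OF g] by blast
    then have "f g = i" by (rule f_eq)
    then show ?thesis using i by blast
  qed
  have "f (a \<otimes> b) = (f a + f b) mod p" if ab: "a \<in> carrier G" "b \<in> carrier G" for a b
  proof -
    obtain k where k: "k \<in> K" "a = k \<otimes> w [^] f a" using f_spec ab by blast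
    obtain l where l: "l \<in> K" "b = l \<otimes> w [^] f b" using f_spec ab by blast
    obtain n where n: "n \<in> K" "w [^] (f a + f b) = n \<otimes> w [^] ((f a + f b) mod p)" using reduce by blast
    have "a \<otimes> b = (k \<otimes> w [^] f a) \<otimes> (l \<otimes> w [^] f b)"
      by (rule arg_cong2[where f = "(\<otimes>)", OF k(2) l(2)])
    also have "\<dots> = (k \<otimes> l) \<otimes> w [^] (f a + f b)"
      using k(1) l(1) Kc w by (simp add: m_ac nat_pow_mult[symmetric])
    also have "\<dots> = (k \<otimes> l \<otimes> n) \<otimes> w [^] ((f a + f b) mod p)"
      unfolding n(2) using k(1) l(1) n(1) Kc w by (simp add: m_assoc)
    finally have ab_eq: "a \<otimes> b = (k \<otimes> l \<otimes> n) \<otimes> w [^] ((f a + f b) mod p)" .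
    have "(f a + f b) mod p < p" using p1 by simp
    moreover have "k \<otimes> l \<otimes> n \<in> K" using k(1) l(1) n(1) subgroup.m_closed[OF sK] by blast
    ultimately show ?thesis using ab_eq by (rule f_eq)
  qed
  then have fm: "functional_mod p f" by (simp add: functional_mod_def)
  show thesis
  proof (rule that[OF fm])
    have "w = \<one> \<otimes> w [^] (1::nat)" using w by simp
    then show "f w = 1" by (rule f_eq[OF p1 subgroup.one_closed[OF sK]])
  next
    fix a assume "a \<in> H"
    then have "a \<in> K" using HK by blast
    moreover have "a = a \<otimes> w [^] (0::nat)" using \<open>a \<in> K\<close> Kc by simp
    moreover have "0 < p" using p1 by simp
    ultimately show "f a = 0" by (intro f_eq)
  qed
qed

section \<open>Criteria for cyclicity\<close>

lemma (in comm_group) cyclic_if_generated_mod_powers: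
  assumes "order G = p ^ n" and w: "w \<in> carrier G"
    and gen: "\<And>g. g \<in> carrier G \<Longrightarrow> \<exists>(i::nat). \<exists>a\<in>carrier G. g = w [^] i \<otimes> a [^] (p::nat)"
  shows "cyclic_group G"
proof -
  \<comment> \<open>Substituting \<open>gen\<close> into itself pushes the second factor into ever
    higher powers; at k = n it is \<one>.\<close>
  have "\<exists>(i::nat). \<exists>a\<in>carrier G. g = w [^] i \<otimes> a [^] (p ^ k)" if "g \<in> carrier G" for g k
    using that
  proof (induction k arbitrary: g)
    case 0
    then have "g = w [^] (0::nat) \<otimes> g [^] (p ^ 0)" by simp
    then show ?case using 0 by blast
  next
    case (Suc k)
    obtain i a where ia: "a \<in> carrier G" "g = w [^] (i::nat) \<otimes> a [^] (p ^ k)" using Suc by blast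
    obtain j b where jb: "b \<in> carrier G" "a = w [^] (j::nat) \<otimes> b [^] p" using gen[OF ia(1)] by blast
    have "g = w [^] (i + j * p ^ k) \<otimes> b [^] (p ^ Suc k)"
      unfolding ia(2) jb(2) using jb(1) w
      by (simp add: nat_pow_distrib nat_pow_pow m_assoc nat_pow_mult[symmetric])
    then show ?case using jb(1) by blast
  qed
  then have *: "\<exists>i::nat. g = w [^] i" if "g \<in> carrier G" for g
    using that[THEN \<open>\<And>k g. g \<in> carrier G \<Longrightarrow> \<exists>(i::nat). \<exists>a\<in>carrier G. g = w [^] i \<otimes> a [^] (p ^ k)\<close>, of n] w
    by (metis assms(1) nat_pow_closed pow_order_eq_1 r_one)
  have "carrier G = range (\<lambda>n::int. w [^] n)"
  proof (intro equalityI subsetI)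
    fix g assume "g \<in> carrier G"
    then obtain i :: nat where "g = w [^] i" using * by blast
    then have "g = w [^] int i" by (simp add: int_pow_int)
    then show "g \<in> range (\<lambda>n::int. w [^] n)" by blast
  qed (use w in auto)
  then show ?thesis using cyclic_group w by blast
qed

text \<open>The p-th power map carries solutions for \<open>Suc k\<close> to solutions for
  \<open>k\<close>, and each nonempty fibre is a coset of its kernel, which has at most p
  elements.\<close>

lemma (in comm_group) card_pow_kernel_le:
  assumes fin: "finite (carrier G)" and c: "card {g \<in> carrier G. g [^] (p::nat) = \<one>} \<le> p"
  shows "card {g \<in> carrier G. g [^] (p ^ k) = \<one>} \<le> p ^ k"
proof (induction k)
  case 0
  have "{g \<in> carrier G. g [^] (p ^ 0) = \<one>} = {\<one>}" by auto
  then show ?case by simp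
next
  case (Suc k)
  let ?B = "{g \<in> carrier G. g [^] (p ^ k) = \<one>}"
  have fiber: "card {g \<in> carrier G. g [^] p = b} \<le> p" for b
  proof (cases "\<exists>g0\<in>carrier G. g0 [^] p = b")
    case True
    then obtain g0 where g0: "g0 \<in> carrier G" "g0 [^] p = b" by blast
    have "{g \<in> carrier G. g [^] p = b} \<subseteq> (\<lambda>g. g0 \<otimes> g) ` {g \<in> carrier G. g [^] p = \<one>}"
    proof
      fix g assume "g \<in> {g \<in> carrier G. g [^] p = b}"
      then have g: "g \<in> carrier G" "g [^] p = b" by auto
      have "g = g0 \<otimes> (inv g0 \<otimes> g)" using g g0 by (simp add: m_assoc[symmetric])
      moreover have "(inv g0 \<otimes> g) [^] p = inv b \<otimes> b"
        using g g0 by (simp add: nat_pow_distrib nat_pow_inv)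
      then have "(inv g0 \<otimes> g) [^] p = \<one>" using g by auto
      ultimately show "g \<in> (\<lambda>g. g0 \<otimes> g) ` {g \<in> carrier G. g [^] p = \<one>}" using g g0 by blast
    qed
    then have "card {g \<in> carrier G. g [^] p = b} \<le> card ((\<lambda>g. g0 \<otimes> g) ` {g \<in> carrier G. g [^] p = \<one>})"
      by (rule card_mono[rotated]) (use fin in simp)
    also have "\<dots> \<le> card {g \<in> carrier G. g [^] p = \<one>}" by (rule card_image_le) (use fin in simp)
    finally show ?thesis using c by simp
  next
    case False
    then have "{g \<in> carrier G. g [^] p = b} = {}" by blast
    then show ?thesis by (metis card.empty zero_le)
  qed
  have "{g \<in> carrier G. g [^] (p ^ Suc k) = \<one>} \<subseteq> (\<Union>b\<in>?B. {g \<in> carrier G. g [^] p = b})"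
    by (auto simp: nat_pow_pow)
  then have "card {g \<in> carrier G. g [^] (p ^ Suc k) = \<one>} \<le> card (\<Union>b\<in>?B. {g \<in> carrier G. g [^] p = b})"
    by (rule card_mono[rotated]) (use fin in auto)
  also have "\<dots> \<le> (\<Sum>b\<in>?B. card {g \<in> carrier G. g [^] p = b})"
    by (rule card_UN_le) (use fin in simp)
  also have "\<dots> \<le> (\<Sum>b\<in>?B. p)" by (rule sum_mono) (rule fiber)
  also have "\<dots> = card ?B * p" by simp
  also have "\<dots> \<le> p ^ k * p" by (rule mult_right_mono[OF Suc.IH]) simp
  finally show ?case by (simp add: mult.commute)
qed

text \<open>If \<open>p ^ (n - 1)\<close> annihilated every element, the kernel bound would
  contradict \<open>order G = p ^ n\<close>; so some element has full order.\<close>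

lemma (in comm_group) cyclic_if_few_roots:
  assumes fin: "finite (carrier G)" and p: "prime p" and ord: "order G = p ^ n" "0 < n"
    and c: "card {g \<in> carrier G. g [^] p = \<one>} \<le> p"
  shows "cyclic_group G"
proof -
  obtain k where k: "n = Suc k" using ord(2) by (cases n) auto
  have "p ^ k < p ^ n" using k prime_gt_1_nat[OF p] by simp
  then have "card {g \<in> carrier G. g [^] (p ^ k) = \<one>} < card (carrier G)"
    using card_pow_kernel_le[OF fin c, of k] ord(1) by (simp add: order_def)
  then have "\<exists>g\<in>carrier G. g [^] (p ^ k) \<noteq> \<one>"
    by (metis (mono_tags, lifting) Collect_cong Collect_mem_eq less_irrefl)
  then obtain g where g: "g \<in> carrier G" "g [^] (p ^ k) \<noteq> \<one>" by blast
  have "ord g dvd p ^ n" using ord_dvd_group_order[OF g(1)] ord by simp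
  then obtain i where i: "i \<le> n" "ord g = p ^ i" using divides_primepow_nat[OF p] by blast
  have "\<not> i \<le> k"
  proof
    assume "i \<le> k"
    then have "ord g dvd p ^ k" using i le_imp_power_dvd by metis
    then show False using g pow_eq_id by blast
  qed
  then have "ord g = order G" using i k ord by (simp add: le_Suc_eq)
  then have "card (generate G {g}) = card (carrier G)" using generate_pow_card[OF g(1)] by (simp add: order_def)
  moreover have "generate G {g} \<subseteq> carrier G" using generate_in_carrier[of "{g}"] g by blast
  ultimately have "generate G {g} = carrier G" using fin card_subset_eq by blast
  then have "carrier G = range (\<lambda>n::int. g [^] n)" using generate_pow[OF g(1)] by (simp add: full_SetCompr_eq)
  then show ?thesis using cyclic_group g by blast
qed

text \<open>The last nontrivial term of a, a^p, a^(p^2), ... has order p.\<close>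

lemma (in group) exists_power_of_order_prime:
  assumes ord: "order G = p ^ n" and a: "a \<in> carrier G" "a \<noteq> \<one>"
  obtains j :: nat where "a [^] j \<noteq> \<one>" "(a [^] j) [^] p = \<one>"
proof -
  define k where "k = (LEAST k. a [^] (p ^ k) = \<one>)"
  have "a [^] (p ^ n) = \<one>" using pow_order_eq_1 a ord by metis
  then have k: "a [^] (p ^ k) = \<one>" unfolding k_def by (rule LeastI)
  then have "k \<noteq> 0" using a by (intro notI) simp
  then obtain l where l: "k = Suc l" by (cases k) auto
  then have "a [^] (p ^ l) \<noteq> \<one>" using not_less_Least[of l "\<lambda>k. a [^] (p ^ k) = \<one>"] k_def by auto
  moreover have "(a [^] (p ^ l)) [^] p = \<one>" using k l a by (simp add: nat_pow_pow mult.commute)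
  ultimately show thesis using that by blast
qed

text \<open>New members are taken from N outside the subgroup generated so far; being distinct, they
  number at most \<open>card N\<close>. The prescribed initial segment allows \<open>z\<close>, and
  in one case a second generator, to be fixed beforehand.\<close>

lemma (in group) exists_generating_chain:
  fixes k :: nat
  assumes fin: "finite (carrier G)" and N: "subgroup N G"
    and good: "\<And>i. i < k \<Longrightarrow> \<tau> i \<in> N \<and> \<tau> i \<notin> generate G (\<tau> ` {..<i})"
  shows "\<exists>\<sigma> m. k \<le> m \<and> (\<forall>i<k. \<sigma> i = \<tau> i) \<and> generate G (\<sigma> ` {..<m}) = N \<and>
    (\<forall>i<m. \<sigma> i \<in> N \<and> \<sigma> i \<notin> generate G (\<sigma> ` {..<i}))"
  using good
proof (induction "card N - k" arbitrary: k \<tau> rule: less_induct)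
  case less
  have finN: "finite N" using fin N subgroup.subset finite_subset by metis
  show ?case
  proof (cases "generate G (\<tau> ` {..<k}) = N")
    case True
    then show ?thesis using less.prems by (intro exI[of _ \<tau>] exI[of _ k]) auto
  next
    case False
    have "\<tau> ` {..<k} \<subseteq> N" using less.prems by auto
    then have "generate G (\<tau> ` {..<k}) \<subseteq> N" using N generate_subgroup_incl by blast
    then obtain w where w: "w \<in> N" "w \<notin> generate G (\<tau> ` {..<k})" using False by blast
    define \<tau>' where "\<tau>' = \<tau>(k := w)"
    have img: "\<tau>' ` {..<i} = \<tau> ` {..<i}" if "i \<le> k" for i using that by (auto simp: \<tau>'_def)
    have good': "\<tau>' i \<in> N \<and> \<tau>' i \<notin> generate G (\<tau>' ` {..<i})" if "i < Suc k" for i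
      using that less.prems[of i] w img[of i] by (cases "i = k") (auto simp: \<tau>'_def)
    have "inj_on \<tau>' {..<Suc k}"
    proof (rule linorder_inj_onI)
      fix i j assume ij: "i < j" "i \<in> {..<Suc k}" "j \<in> {..<Suc k}"
      have "\<tau>' i \<in> generate G (\<tau>' ` {..<j})" using ij by (intro generate.incl) auto
      then show "\<tau>' i \<noteq> \<tau>' j" using good'[of j] ij by auto
    qed auto
    then have "card (\<tau>' ` {..<Suc k}) = Suc k" by (simp add: card_image)
    moreover have "card (\<tau>' ` {..<Suc k}) \<le> card N" using good' finN by (intro card_mono) auto
    ultimately have "card N - Suc k < card N - k" by simp
    from less.hyps[OF this good'] obtain \<sigma> m where \<sigma>:
      "Suc k \<le> m" "\<forall>i<Suc k. \<sigma> i = \<tau>' i" "generate G (\<sigma> ` {..<m}) = N"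
      "\<forall>i<m. \<sigma> i \<in> N \<and> \<sigma> i \<notin> generate G (\<sigma> ` {..<i})" by blast
    have "\<forall>i<k. \<sigma> i = \<tau> i" using \<sigma>(2) by (simp add: \<tau>'_def)
    then show ?thesis using \<sigma> Suc_leD by blast
  qed
qed

lemma (in comm_group) subgroup_powers: "subgroup {a [^] (p::nat) | a. a \<in> carrier G} G"
proof (rule subgroupI)
  show "{a [^] p | a. a \<in> carrier G} \<noteq> {}" by auto
  show "inv b \<in> {a [^] p | a. a \<in> carrier G}" if "b \<in> {a [^] p | a. a \<in> carrier G}" for b
    using that by (auto simp: nat_pow_inv[symmetric])
  show "b \<otimes> c \<in> {a [^] p | a. a \<in> carrier G}"
    if "b \<in> {a [^] p | a. a \<in> carrier G}" "c \<in> {a [^] p | a. a \<in> carrier G}" for b c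
    using that by (auto simp: nat_pow_distrib[symmetric])
qed auto

text \<open>Modulo the subgroup P of p-th powers, u is nonzero, and some x lies outside its span
  because otherwise G would be cyclic. Exchanging roles, u is outside the span of x, so f and h can
  be chosen as coordinates dual to x and u.\<close>

lemma (in comm_group) independent_functionals:
  assumes fin: "finite (carrier G)" and p: "prime p" and ord: "order G = p ^ n"
    and nc: "\<not> cyclic_group G" and u: "u \<in> carrier G" "\<And>a. a \<in> carrier G \<Longrightarrow> u \<noteq> a [^] p"
  obtains x and f h :: "'a \<Rightarrow> nat"
  where "x \<in> carrier G"
    "functional_mod p f" "functional_mod p h"
    "f x = 1" "f u = 0" "h x = 0" "h u = 1"
    "\<forall>a\<in>carrier G. f (a [^] p) = 0 \<and> h (a [^] p) = 0"
proof -
  define P where "P = {a [^] p | a. a \<in> carrier G}"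
  define Q where "Q w = {k \<otimes> w [^] (j::nat) | k j. k \<in> P}" for w
  have P: "subgroup P G" unfolding P_def by (rule subgroup_powers)
  have Q: "subgroup (Q w) G" if "w \<in> carrier G" for w
    unfolding Q_def by (rule subgroup_mult_powers[OF fin P that])
  have Pc: "a \<in> P \<Longrightarrow> a \<in> carrier G" for a by (auto simp: P_def)
  have PQ: "a \<in> Q w" if "a \<in> P" for a w
  proof -
    have "a = a \<otimes> w [^] (0::nat)" using Pc[OF that] by simp
    then show ?thesis unfolding Q_def using that by blast
  qed
  have pP: "a [^] p \<in> P" if "a \<in> carrier G" for a using that by (auto simp: P_def)
  have wQ: "w \<in> Q w" if "w \<in> carrier G" for w
  proof -
    have "w = \<one> \<otimes> w [^] (1::nat)" using that by simp
    then show ?thesis unfolding Q_def using subgroup.one_closed[OF P] by blast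
  qed
  have "\<exists>x\<in>carrier G. x \<notin> Q u"
  proof (rule ccontr)
    assume all: "\<not> (\<exists>x\<in>carrier G. x \<notin> Q u)"
    have "\<exists>(i::nat). \<exists>a\<in>carrier G. g = u [^] i \<otimes> a [^] p" if g: "g \<in> carrier G" for g
    proof -
      have "g \<in> Q u" using all g by blast
      then obtain a and j :: nat where "a \<in> carrier G" "g = a [^] p \<otimes> u [^] j"
        unfolding Q_def P_def by blast
      then have "g = u [^] j \<otimes> a [^] p" using m_comm u(1) by simp
      then show ?thesis using \<open>a \<in> carrier G\<close> by blast
    qed
    then show False using cyclic_if_generated_mod_powers[OF ord u(1)] nc by blast
  qed
  then obtain x where x: "x \<in> carrier G" "x \<notin> Q u" by blast
  have "u \<notin> Q x"
  proof
    assume "u \<in> Q x"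
    then obtain k and j :: nat where k: "k \<in> P" "u = k \<otimes> x [^] j" unfolding Q_def by blast
    show False
    proof (cases "p dvd j")
      case True
      then obtain i where "j = i * p" by (metis dvd_def mult.commute)
      then have "x [^] j = (x [^] i) [^] p" using x by (simp add: nat_pow_pow)
      then have "x [^] j \<in> P" using pP x by simp
      then have "u \<in> P" using k subgroup.m_closed[OF P] by simp
      then show False using u(2) unfolding P_def by blast
    next
      case False
      have "x [^] j = inv k \<otimes> u" using k x Pc by (simp add: m_assoc[symmetric])
      moreover have "inv k \<in> Q u" by (rule PQ[OF subgroup.m_inv_closed[OF P k(1)]])
      ultimately have "x [^] j \<in> Q u" using subgroup.m_closed[OF Q[OF u(1)]] wQ[OF u(1)] by simp
      then have "x \<in> Q u" using pow_in_subgroup_cancel[OF p Q[OF u(1)] PQ[OF pP] x(1) False] by blast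
      then show False using x by blast
    qed
  qed
  obtain f :: "'a \<Rightarrow> nat" where f: "functional_mod p f" "f x = 1" "\<And>a. a \<in> Q u \<Longrightarrow> f a = 0"
    using exists_functional_mod_prime[OF fin p Q[OF u(1)] PQ[OF pP] x] by metis
  obtain h :: "'a \<Rightarrow> nat" where h: "functional_mod p h" "h u = 1" "\<And>a. a \<in> Q x \<Longrightarrow> h a = 0"
    using exists_functional_mod_prime[OF fin p Q[OF x(1)] PQ[OF pP] u(1) \<open>u \<notin> Q x\<close>] by metis
  have fP: "\<forall>a\<in>carrier G. f (a [^] p) = 0 \<and> h (a [^] p) = 0"
    using f(3)[OF PQ[OF pP]] h(3)[OF PQ[OF pP]] by blast
  show thesis
    by (rule that[OF x(1) f(1) h(1) f(2) f(3)[OF wQ[OF u(1)]] h(3)[OF wQ[OF x(1)]] h(2) fP])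
qed

subsection \<open>An automorphism of order p\<close>

text \<open>
  The parameter \<open>e\<close> is the value \<open>h y\<close>: it is \<open>1\<close> in the case \<open>y = u\<close> and \<open>0\<close> in the case \<open>y \<in> N\<close>.
\<close>

locale cayley_data = comm_group G for G (structure) +
  fixes p :: nat and f h :: "'a \<Rightarrow> nat" and e :: nat and x u y z :: 'a
    and \<tau> :: "nat \<Rightarrow> 'a" and m :: nat
  assumes fin: "finite (carrier G)"
    and odd_order: "odd (order G)"
    and prime: "prime p" and odd_p: "odd p"
    and closed [simp]: "x \<in> carrier G" "u \<in> carrier G" "y \<in> carrier G" "z \<in> carrier G"
    and f_functional: "functional_mod p f" and h_functional: "functional_mod p h"
    and f_vals [simp]: "f x = 1" "f u = 0" "f y = 0" "f z = 0"
    and h_vals [simp]: "h x = 0" "h u = 1" "h y = e" "h z = 0"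
    and e_cases: "e = 1 \<and> u = y \<or> e = 0"
    and y_pow_p: "y [^] p = \<one>" and z_pow_p: "z [^] p = \<one>"
    and independent: "y [^] (k::nat) = z [^] (l::nat) \<Longrightarrow> p dvd k"
    and \<tau>_0: "\<tau> 0 = z"
    and \<tau>_closed: "i \<le> m \<Longrightarrow> \<tau> i \<in> carrier G"
    and \<tau>_new: "i \<le> m \<Longrightarrow> \<tau> i \<notin> generate G (\<tau> ` {..<i})"
    and \<tau>_generate: "generate G (\<tau> ` {..m}) = {a \<in> carrier G. f a = 0 \<and> h a = 0}"
    and \<tau>_avoids: "\<lbrakk>e = 0; i \<le> m\<rbrakk> \<Longrightarrow> \<tau> i \<noteq> y [^] (k::nat) \<and> \<tau> i \<noteq> (y \<otimes> z) [^] k"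
begin

lemma p_ge_3: "3 \<le> p"
proof -
  have "2 \<le> p" using prime by (rule prime_ge_2_nat)
  moreover have "p \<noteq> 2" using odd_p by auto
  ultimately show ?thesis by linarith
qed

lemma p_pos: "0 < p" using p_ge_3 by simp

lemmas f_mult = functional_mod_mult[OF f_functional]
lemmas h_mult = functional_mod_mult[OF h_functional]
lemmas f_one [simp] = functional_mod_one[OF f_functional p_pos]
lemmas h_one [simp] = functional_mod_one[OF h_functional p_pos]
lemmas f_less [simp] = functional_mod_less[OF f_functional p_pos]
lemmas h_less [simp] = functional_mod_less[OF h_functional p_pos]
lemmas f_pow = functional_mod_pow[OF f_functional p_pos]
lemmas h_pow = functional_mod_pow[OF h_functional p_pos]

lemma y_pow_cong: "[i = j] (mod p) \<Longrightarrow> y [^] i = y [^] j"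
  by (rule pow_cong_exponent[OF _ y_pow_p]) auto

lemma z_pow_cong: "[i = j] (mod p) \<Longrightarrow> z [^] i = z [^] j"
  by (rule pow_cong_exponent[OF _ z_pow_p]) auto

text \<open>From here on \<open>(p - 1) * k\<close> serves as the exponent \<open>- k\<close> of
  z.\<close>

lemma z_pow_cancel: "z [^] (k::nat) \<otimes> z [^] ((p - 1) * k) = \<one>"
proof -
  have "k + (p - 1) * k = p * k" using p_ge_3 by (cases p) auto
  then have "z [^] (k + (p - 1) * k) = z [^] (0::nat)" by (intro z_pow_cong) (simp add: cong_0_iff)
  then show ?thesis by (simp add: nat_pow_mult)
qed

text \<open>
  This is the \<open>k\<close>-th iterate of \<open>g \<mapsto> g y\<^bsup>f g\<^esup> z\<^bsup>h g\<^esup>\<close>; the binomial coefficient arises from \<open>h y = e\<close>.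
\<close>

definition \<alpha> :: "nat \<Rightarrow> 'a \<Rightarrow> 'a" where
  "\<alpha> k a = a \<otimes> y [^] (k * f a) \<otimes> z [^] (k * h a + (k choose 2) * e * f a)"

lemma \<alpha>_closed [simp]: "a \<in> carrier G \<Longrightarrow> \<alpha> k a \<in> carrier G"
  by (simp add: \<alpha>_def)

lemma \<alpha>_mult:
  assumes "a \<in> carrier G" "b \<in> carrier G"
  shows "\<alpha> k (a \<otimes> b) = \<alpha> k a \<otimes> \<alpha> k b"
proof -
  have 1: "y [^] (k * f (a \<otimes> b)) = y [^] (k * f a) \<otimes> y [^] (k * f b)"
    unfolding nat_pow_mult[OF closed(3)]
    by (rule y_pow_cong) (simp add: assms f_mult cong_def mod_simps algebra_simps)
  have "z [^] (k * h (a \<otimes> b) + (k choose 2) * e * f (a \<otimes> b))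
      = z [^] (k * (h a + h b) + (k choose 2) * e * (f a + f b))"
    by (rule z_pow_cong, intro cong_add cong_mult)
       (auto simp: assms f_mult h_mult cong_def)
  also have "\<dots> = z [^] (k * h a + (k choose 2) * e * f a) \<otimes> z [^] (k * h b + (k choose 2) * e * f b)"
    by (simp add: nat_pow_mult algebra_simps)
  finally show ?thesis using assms 1 by (simp add: \<alpha>_def m_ac)
qed

lemma f_\<alpha> [simp]: "a \<in> carrier G \<Longrightarrow> f (\<alpha> k a) = f a"
  by (simp add: \<alpha>_def f_mult f_pow)

lemma h_\<alpha>: "a \<in> carrier G \<Longrightarrow> h (\<alpha> k a) = (h a + k * e * f a) mod p"
  by (simp add: \<alpha>_def h_mult h_pow mod_simps algebra_simps)

text \<open>Applying \<open>\<alpha> l\<close> raises h by \<open>l * e * f a\<close>; multiplied by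
  k, this is the cross term of \<open>choose_two_add\<close>.\<close>

lemma \<alpha>_add:
  assumes a: "a \<in> carrier G"
  shows "\<alpha> k (\<alpha> l a) = \<alpha> (k + l) a"
proof -
  have "z [^] (k * h (\<alpha> l a) + (k choose 2) * e * f a)
      = z [^] (k * (h a + l * e * f a) + (k choose 2) * e * f a)"
    by (rule z_pow_cong, intro cong_add cong_mult) (auto simp: a h_\<alpha> cong_def)
  then have "\<alpha> k (\<alpha> l a) = a \<otimes> (y [^] (l * f a) \<otimes> y [^] (k * f a)) \<otimes>
     (z [^] (l * h a + (l choose 2) * e * f a) \<otimes> z [^] (k * (h a + l * e * f a) + (k choose 2) * e * f a))"
    using a by (simp add: \<alpha>_def[of k "\<alpha> l a"]) (simp add: \<alpha>_def m_ac)
  also have "\<dots> = \<alpha> (k + l) a"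
    using a by (simp add: \<alpha>_def nat_pow_mult choose_two_add algebra_simps)
  finally show ?thesis .
qed

lemma \<alpha>_dvd: "a \<in> carrier G \<Longrightarrow> p dvd k \<Longrightarrow> \<alpha> k a = a"
proof -
  assume a: "a \<in> carrier G" and k: "p dvd k"
  have "y [^] (k * f a) = y [^] (0::nat)"
    by (rule y_pow_cong) (simp add: k cong_0_iff)
  moreover have "z [^] (k * h a + (k choose 2) * e * f a) = z [^] (0::nat)"
    by (rule z_pow_cong) (simp add: k odd_dvd_choose_two odd_p cong_0_iff)
  ultimately show ?thesis using a by (simp add: \<alpha>_def)
qed

lemma \<alpha>_0 [simp]: "a \<in> carrier G \<Longrightarrow> \<alpha> 0 a = a"
  by (rule \<alpha>_dvd) auto

lemma \<alpha>_inverse: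
  obtains k' where "\<And>a. a \<in> carrier G \<Longrightarrow> \<alpha> k' (\<alpha> k a) = a" "\<And>a. a \<in> carrier G \<Longrightarrow> \<alpha> k (\<alpha> k' a) = a"
proof
  have "(p - 1) * k + k = p * k" using p_ge_3 by (cases p) auto
  then have d: "p dvd (p - 1) * k + k" "p dvd k + (p - 1) * k" by (simp_all add: add.commute)
  fix a assume "a \<in> carrier G"
  then show "\<alpha> ((p - 1) * k) (\<alpha> k a) = a" "\<alpha> k (\<alpha> ((p - 1) * k) a) = a"
    using d by (simp_all only: \<alpha>_add \<alpha>_dvd)
qed

lemma \<alpha>_x: "\<alpha> k x = x \<otimes> y [^] k \<otimes> z [^] ((k choose 2) * e)"
  by (simp add: \<alpha>_def)

lemma \<alpha>_u: "\<alpha> k u = u \<otimes> z [^] k"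
  by (simp add: \<alpha>_def)

lemma \<alpha>_fixed: "a \<in> carrier G \<Longrightarrow> f a = 0 \<Longrightarrow> h a = 0 \<Longrightarrow> \<alpha> k a = a"
  by (simp add: \<alpha>_def)

lemma \<alpha>_one [simp]: "\<alpha> k \<one> = \<one>"
  by (simp add: \<alpha>_fixed)

lemma \<alpha>_mod: "a \<in> carrier G \<Longrightarrow> \<alpha> (k mod p) a = \<alpha> k a"
proof -
  assume a: "a \<in> carrier G"
  have "\<alpha> k a = \<alpha> (k mod p + p * (k div p)) a" by simp
  also have "\<dots> = \<alpha> (k mod p) (\<alpha> (p * (k div p)) a)" by (simp only: \<alpha>_add a)
  also have "\<dots> = \<alpha> (k mod p) a" by (simp add: \<alpha>_dvd a)
  finally show ?thesis ..
qed

text \<open>(1 choose 2) = 0, so no power of z appears. This is why \<open>X\<close> is a single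
  orbit for e = 1 (\<open>X_type1\<close>).\<close>

lemma xu_type1: "e = 1 \<Longrightarrow> x \<otimes> u = \<alpha> 1 x"
proof -
  assume "e = 1"
  then have "u = y" using e_cases by simp
  then show ?thesis by (simp add: \<alpha>_x numeral_2_eq_2)
qed

subsection \<open>The connection set\<close>

text \<open>The partial products start at \<open>\<tau> 1\<close>, because
  \<open>\<tau> 0 = z\<close> is absorbed by the <z>-cosets in \<open>L\<close>. As
  \<open>F i\<close> stops before \<open>\<tau> i\<close>, the home of \<open>c j\<close> is
  \<open>F (Suc j)\<close>.\<close>

fun c :: "nat \<Rightarrow> 'a" where
  "c 0 = \<one>"
| "c (Suc j) = c j \<otimes> \<tau> (Suc j)"

abbreviation F :: "nat \<Rightarrow> 'a set" where
  "F i \<equiv> generate G (\<tau> ` {..<i})"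

lemma F_subgroup: "i \<le> Suc m \<Longrightarrow> subgroup (F i) G"
  by (rule generate_is_subgroup) (use \<tau>_closed in auto)

lemma F_mono: "i \<le> j \<Longrightarrow> F i \<subseteq> F j"
  by (rule mono_generate) auto

lemma \<tau>_in_F: "i < j \<Longrightarrow> \<tau> i \<in> F j"
  by (rule generate.incl) auto

lemma z_in_F: "0 < j \<Longrightarrow> j \<le> Suc m \<Longrightarrow> z [^] (k::nat) \<in> F j"
  using \<tau>_in_F[of 0 j] \<tau>_0 subgroup_nat_pow_closed F_subgroup by auto

lemma c_in_F: "j \<le> m \<Longrightarrow> c j \<in> F (Suc j)"
proof (induction j)
  case 0
  then show ?case by (simp add: generate.one)
next
  case (Suc j)
  then have "c j \<in> F (Suc (Suc j))" using F_mono[of "Suc j" "Suc (Suc j)"] by auto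
  then show ?case using \<tau>_in_F[of "Suc j" "Suc (Suc j)"] by (simp add: generate.eng)
qed

lemma c_closed [simp]: "j \<le> m \<Longrightarrow> c j \<in> carrier G"
  using c_in_F F_subgroup[of "Suc j"] subgroup.mem_carrier by fastforce

lemma c_not_in_F:
  assumes "0 < j" "j \<le> m" "i \<le> j" shows "c j \<notin> F i"
proof
  assume "c j \<in> F i"
  then have cj: "c j \<in> F j" using F_mono assms(3) by blast
  obtain i where i: "j = Suc i" using assms(1) by (cases j) auto
  have "\<tau> j \<in> F j"
    by (rule subgroup_cancel_left[of _ "c i"])
       (use assms cj i c_in_F[of i] F_subgroup[of j] \<tau>_closed[of j] in auto)
  then show False using \<tau>_new assms(2) by blast
qed

text \<open>For i < j every factor other than \<open>c j\<close> lies in \<open>F j\<close>, which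
  contains z because j > 0.\<close>

lemma c_distinct:
  assumes "i \<le> m" "j \<le> m" "c i \<otimes> z [^] (k::nat) = c j \<otimes> z [^] (l::nat)"
  shows "i = j"
proof -
  have *: False if ij: "i < j" "j \<le> m" and eq: "c i \<otimes> z [^] (k::nat) = c j \<otimes> z [^] (l::nat)"
    for i j k l
  proof -
    have "c j \<otimes> z [^] l \<in> F j"
      unfolding eq[symmetric] using c_in_F[of i] F_mono[of "Suc i" j] z_in_F[of j k] ij
      by (intro subgroup.m_closed[OF F_subgroup]) auto
    then have "c j \<in> F j"
      using subgroup_cancel_right[OF F_subgroup z_in_F[of j l]] ij by auto
    then show False using c_not_in_F[of j j] ij by simp
  qed
  show ?thesis
    using *[of i j] *[of j i] assms by (metis linorder_neqE_nat)
qed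

text \<open>Both sides are compared by the highest \<open>F\<close> they reach; only the step from
  \<open>c (i - 1)\<close> to \<open>c i\<close> survives. The delicate case is j = i with l < i,
  where \<open>\<tau> i \<otimes> \<tau> i\<close> falls into \<open>F i\<close>, so odd order puts
  \<open>\<tau> i\<close> there as well.\<close>

lemma \<tau>_mult_c:
  assumes i: "0 < i" "i \<le> m" and j: "j \<le> m" and l: "l \<le> m"
    and eq: "\<tau> i \<otimes> c j = c l \<otimes> z [^] (k::nat)"
  shows "i = Suc j \<and> l = i"
proof -
  have [simp]: "\<tau> i \<in> carrier G" using i \<tau>_closed by simp
  have rhs: "c l \<otimes> z [^] k \<in> F (Suc l)"
    using l c_in_F z_in_F by (intro subgroup.m_closed[OF F_subgroup]) auto
  have big: False if ln: "n < l" and mem: "\<tau> i \<otimes> c j \<in> F (Suc n)" for n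
  proof -
    have "c l \<otimes> z [^] k \<in> F l" using mem ln F_mono[of "Suc n" l] eq by auto
    then have "c l \<in> F l"
      using subgroup_cancel_right[OF F_subgroup z_in_F[of l k]] l ln by auto
    then show False using c_not_in_F[of l l] l ln by auto
  qed
  show ?thesis
  proof (cases "j < i")
    case True
    have cj: "c j \<in> F i" using c_in_F[OF j] F_mono[of "Suc j" i] True by auto
    have lhs: "\<tau> i \<otimes> c j \<in> F (Suc i)"
      using cj F_mono[of i "Suc i"] \<tau>_in_F[of i "Suc i"] i
      by (intro subgroup.m_closed[OF F_subgroup]) auto
    have "\<not> i < l" using big lhs by blast
    moreover have "\<not> l < i"
    proof
      assume "l < i"
      then have "\<tau> i \<otimes> c j \<in> F i" using rhs F_mono[of "Suc l" i] eq by auto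
      then have "\<tau> i \<in> F i"
        using subgroup_cancel_right[OF F_subgroup cj] i by auto
      then show False using \<tau>_new i by blast
    qed
    ultimately have "l = i" by simp
    obtain i' where i': "i = Suc i'" using i by (cases i) auto
    have "\<tau> i \<otimes> c j = \<tau> i \<otimes> (c i' \<otimes> z [^] k)"
      using eq i j by (simp add: \<open>l = i\<close> i' m_ac \<tau>_closed)
    then have "c j = c i' \<otimes> z [^] k"
      using i i' j by (simp add: \<tau>_closed)
    then have "j = i'"
      using c_distinct[of j i' 0 k] i i' j by simp
    then show ?thesis using \<open>l = i\<close> i' by simp
  next
    case False
    have "\<tau> i \<otimes> c j \<in> F (Suc j)"
      using False i j c_in_F[OF j] \<tau>_in_F[of i "Suc j"]
      by (intro subgroup.m_closed[OF F_subgroup]) auto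
    then have "\<not> j < l" using big by blast
    moreover have "l \<noteq> j"
    proof
      assume "l = j"
      then have "\<tau> i = z [^] k" using eq j by (simp add: m_comm[of "\<tau> i"])
      then have "\<tau> i \<in> F i" using z_in_F i by simp
      then show False using \<tau>_new i by blast
    qed
    moreover have False if "l < j"
    proof -
      have mem: "\<tau> i \<otimes> c j \<in> F j" using rhs F_mono[of "Suc l" j] that eq by auto
      show False
      proof (cases "i < j")
        case True
        then have "c j \<in> F j"
          using subgroup_cancel_left[OF F_subgroup \<tau>_in_F[OF True]] mem j by auto
        then show False using c_not_in_F[of j j] j True by auto
      next
        case nless: False
        then have ij: "j = i" using False by simp
        obtain i' where i': "i = Suc i'" using i by (cases i) auto
        have [simp]: "c i' \<in> carrier G" using i i' by simp
        have "\<tau> i \<otimes> c j = (\<tau> i \<otimes> \<tau> i) \<otimes> c i'"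
          using ij i' \<open>\<tau> i \<in> carrier G\<close> by (simp add: m_ac)
        then have tt: "(\<tau> i \<otimes> \<tau> i) \<otimes> c i' \<in> F i" using mem ij by metis
        have sg: "subgroup (F i) G" using F_subgroup i by simp
        have ci': "c i' \<in> F i" using c_in_F[of i'] i i' by simp
        have "\<tau> i \<otimes> \<tau> i \<in> carrier G" by simp
        from subgroup_cancel_right[OF sg ci' this tt]
        have "\<tau> i \<otimes> \<tau> i \<in> F i" .
        then have "\<tau> i \<in> F i"
          using odd_order_root_in_subgroup[OF odd_order sg] \<open>\<tau> i \<in> carrier G\<close> by blast
        then show False using \<tau>_new i by blast
      qed
    qed
    ultimately show ?thesis using linorder_neqE_nat by blast
  qed
qed

text \<open>The largest of the three indices either occurs once, which expresses that
  \<open>\<tau>\<close> through earlier ones, or occurs as i = j, where odd order extracts a square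
  root. It cannot be shared with l, since no \<open>\<tau>\<close> is \<one>.\<close>

lemma \<tau>_mult_\<tau>:
  assumes "i \<le> m" "j \<le> m" "l \<le> m"
  shows "\<tau> i \<otimes> \<tau> j \<noteq> \<tau> l"
proof
  assume eq: "\<tau> i \<otimes> \<tau> j = \<tau> l"
  have cl [simp]: "\<tau> i \<in> carrier G" "\<tau> j \<in> carrier G" "\<tau> l \<in> carrier G"
    using assms \<tau>_closed by auto
  have ne: "\<tau> i \<noteq> \<one>" "\<tau> j \<noteq> \<one>"
    using \<tau>_new assms generate.one[of G] by metis+
  have il: "i \<noteq> l" "j \<noteq> l" using eq ne by auto
  define n where "n = max i (max j l)"
  have n: "n \<le> m" using assms by (simp add: n_def)
  note sg = F_subgroup[of n]
  consider "l = n" "i < n" "j < n" | "i = n" "j < n" "l < n" | "j = n" "i < n" "l < n"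
    | "i = n" "j = n" "l < n"
    using il by (fastforce simp: n_def max_def split: if_splits)
  then show False
  proof cases
    case 1
    then have "\<tau> n \<in> F n"
      using eq subgroup.m_closed[OF sg \<tau>_in_F[of i n] \<tau>_in_F[of j n]] n by auto
    then show False using \<tau>_new n by blast
  next
    case 2
    then have "\<tau> n \<in> F n"
      using eq subgroup_cancel_right[OF sg \<tau>_in_F[of j n], of "\<tau> i"] \<tau>_in_F[of l n] n cl by auto
    then show False using \<tau>_new n by blast
  next
    case 3
    then have "\<tau> n \<in> F n"
      using eq subgroup_cancel_left[OF sg \<tau>_in_F[of i n], of "\<tau> j"] \<tau>_in_F[of l n] n cl by auto
    then show False using \<tau>_new n by blast
  next
    case 4
    then have "\<tau> n \<in> F n"
      using eq odd_order_root_in_subgroup[OF odd_order sg, of "\<tau> i"] \<tau>_in_F[of l n] n cl by auto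
    then show False using \<tau>_new n by blast
  qed
qed

definition T :: "'a set" where "T = \<tau> ` {..m}"
definition L :: "nat \<Rightarrow> 'a set" where "L j = range (\<lambda>k::nat. u \<otimes> c j \<otimes> z [^] k)"
definition U :: "'a set" where "U = (\<Union>j\<in>{..m}. L j)"
definition X0 :: "'a set" where "X0 = range (\<lambda>k. \<alpha> k x)"
definition X :: "'a set" where "X = X0 \<union> range (\<lambda>k. \<alpha> k (x \<otimes> u))"
definition S :: "'a set" where "S = T \<union> U \<union> X"

lemma ker_mem: "a \<in> F i \<Longrightarrow> i \<le> Suc m \<Longrightarrow> a \<in> carrier G \<and> f a = 0 \<and> h a = 0"
  using F_mono[of i "Suc m"] \<tau>_generate by (auto simp: lessThan_Suc_atMost)

lemma T_D: "r \<in> T \<Longrightarrow> r \<in> carrier G \<and> f r = 0 \<and> h r = 0"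
  unfolding T_def using ker_mem[of _ "Suc m"] \<tau>_in_F[of _ "Suc m"] by fastforce

lemma c_D: "j \<le> m \<Longrightarrow> f (c j) = 0 \<and> h (c j) = 0"
  using ker_mem[OF c_in_F] by auto

lemma U_D: "r \<in> U \<Longrightarrow> r \<in> carrier G \<and> f r = 0 \<and> h r = 1"
  unfolding U_def L_def using c_D p_ge_3 by (auto simp: f_mult h_mult f_pow h_pow)

lemma X_D: "r \<in> X \<Longrightarrow> r \<in> carrier G \<and> f r = 1"
  unfolding X_def X0_def using p_ge_3 by (auto simp: f_mult)

lemma h_\<alpha>_type2:
  assumes "e = 0" and a: "a \<in> carrier G"
  shows "h (\<alpha> k a) = h a"
proof -
  have "k * e * f a = 0" using assms(1) by simp
  then show ?thesis using h_\<alpha>[OF a, of k] h_less[OF a] by (simp only: add_0_right mod_less)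
qed

lemma h_xu [simp]: "h (x \<otimes> u) = 1"
  using p_ge_3 by (simp add: h_mult)

lemma X_h_type2:
  assumes "e = 0" shows "r \<in> X \<Longrightarrow> h r = 0 \<or> h r = 1"
  unfolding X_def X0_def by (auto simp: h_\<alpha>_type2[OF assms])

lemma \<alpha>_xu_type2:
  assumes "e = 0"
  shows "\<alpha> k (x \<otimes> u) = (x \<otimes> u) \<otimes> (y [^] k \<otimes> z [^] k)"
proof -
  have "(k choose 2) * e = 0" using assms by simp
  then have "\<alpha> k x = x \<otimes> y [^] k" unfolding \<alpha>_x by (simp only: nat_pow_0) simp
  then show ?thesis by (simp add: \<alpha>_mult \<alpha>_u m_ac)
qed

lemma X0_subset: "X0 \<subseteq> X" by (auto simp: X_def)

lemma X_type1:
  assumes "e = 1"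
  shows "X = X0"
proof -
  have "\<alpha> k (x \<otimes> u) = \<alpha> (k + 1) x" for k
    by (simp only: xu_type1[OF assms] \<alpha>_add[OF closed(1)])
  then show ?thesis by (auto simp: X_def X0_def simp del: Suc_eq_plus1 add_Suc_right)
qed

lemma S_closed: "r \<in> S \<Longrightarrow> r \<in> carrier G"
  using T_D U_D X_D by (auto simp: S_def)

section \<open>Products of elements of S that fall back into S\<close>

lemma disjoint: "r \<in> T \<Longrightarrow> r \<notin> U" "r \<in> T \<Longrightarrow> r \<notin> X" "r \<in> U \<Longrightarrow> r \<notin> X"
  using T_D U_D X_D by fastforce+

lemma \<tau>_ne_one: "i \<le> m \<Longrightarrow> \<tau> i \<noteq> \<one>"
  using \<tau>_new generate.one[of G] by metis

lemma one_notin_S: "\<one> \<notin> S"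
  using U_D[of \<one>] X_D[of \<one>] \<tau>_ne_one unfolding S_def T_def by fastforce

lemma \<tau>_in_T: "i \<le> m \<Longrightarrow> \<tau> i \<in> T" by (auto simp: T_def)
lemma z_in_T: "z \<in> T" using \<tau>_in_T[of 0] \<tau>_0 by simp

text \<open>For e = 0 the orbit of x is x <y>, so r would be a power of y, against
  \<open>\<tau>_avoids\<close>. For e = 1 comparing h gives p dvd j, and then r = \<one>.\<close>

lemma \<tau>_mult_x_notin_orbit:
  assumes r: "r \<in> T"
  shows "r \<otimes> x \<noteq> \<alpha> j x"
proof
  assume eq: "r \<otimes> x = \<alpha> j x"
  have rc [simp]: "r \<in> carrier G" and hr: "h r = 0" using T_D[OF r] by auto
  obtain i where i: "r = \<tau> i" "i \<le> m" using r by (auto simp: T_def)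
  have "x \<otimes> r = x \<otimes> (y [^] j \<otimes> z [^] ((j choose 2) * e))"
    using eq by (simp add: \<alpha>_x m_ac)
  then have r_eq: "r = y [^] j \<otimes> z [^] ((j choose 2) * e)" by simp
  show False
  proof (cases "e = 0")
    case True
    then have "r = y [^] j" using r_eq by simp
    then show False using \<tau>_avoids[OF True, of i j] i by simp
  next
    case False
    then have "e = 1" using e_cases by auto
    have "h r = (j * e) mod p" by (simp add: r_eq h_mult h_pow)
    then have "p dvd j" using hr \<open>e = 1\<close> by auto
    then have "r \<otimes> x = x" using eq \<alpha>_dvd by simp
    then have "r = \<one>" using r_cancel_one by simp
    then show False using \<tau>_ne_one i by simp
  qed
qed

text \<open>For e = 0 the orbit of x u is x u <y z>; this is the origin of the powers of y z in
  \<open>\<tau>_avoids\<close>.\<close>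

lemma \<tau>_mult_xu_notin_orbit:
  assumes r: "r \<in> T" and e: "e = 0"
  shows "r \<otimes> (x \<otimes> u) \<noteq> \<alpha> j (x \<otimes> u)"
proof
  assume eq: "r \<otimes> (x \<otimes> u) = \<alpha> j (x \<otimes> u)"
  have rc [simp]: "r \<in> carrier G" using T_D[OF r] by auto
  obtain i where i: "r = \<tau> i" "i \<le> m" using r by (auto simp: T_def)
  have "(x \<otimes> u) \<otimes> r = (x \<otimes> u) \<otimes> (y [^] j \<otimes> z [^] j)"
    using eq m_comm[of r "x \<otimes> u"] by (simp add: \<alpha>_xu_type2[OF e])
  then have "r = y [^] j \<otimes> z [^] j" by (subst (asm) Units_l_cancel) auto
  then show False using \<tau>_avoids[OF e, of i j] i by (simp add: nat_pow_distrib)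
qed

text \<open>Since \<alpha> fixes T pointwise, a coincidence anywhere on an orbit can be carried back
  to its base point x or x u. For e = 0 the value of h keeps the two orbits apart.\<close>

lemma T_mult_X:
  assumes r: "r \<in> T" and s: "s \<in> X"
  shows "r \<otimes> s \<notin> X"
proof
  assume rs: "r \<otimes> s \<in> X"
  have rc [simp]: "r \<in> carrier G" and fh: "f r = 0" "h r = 0" using T_D[OF r] by auto
  have shift: "\<exists>j. r \<otimes> q = \<alpha> j q'"
    if "r \<otimes> \<alpha> k q = \<alpha> l q'" and [simp]: "q \<in> carrier G" "q' \<in> carrier G" for k l q q'
  proof -
    obtain k' where k': "\<alpha> k' (\<alpha> k a) = a" if "a \<in> carrier G" for a using \<alpha>_inverse by metis
    have "r \<otimes> q = \<alpha> k' (r \<otimes> \<alpha> k q)" using k' fh by (simp add: \<alpha>_mult \<alpha>_fixed)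
    also have "\<dots> = \<alpha> (k' + l) q'" using that by (simp add: \<alpha>_add)
    finally show ?thesis by blast
  qed
  show False
  proof (cases "e = 0")
    case False
    then have "X = X0" using e_cases X_type1 by auto
    then obtain k l where "s = \<alpha> k x" "r \<otimes> s = \<alpha> l x" using s rs by (auto simp: X0_def)
    then show False using shift[of k x l x] \<tau>_mult_x_notin_orbit[OF r] by auto
  next
    case True
    have 1: "r \<otimes> x \<noteq> \<alpha> j (x \<otimes> u)" for j
    proof
      assume "r \<otimes> x = \<alpha> j (x \<otimes> u)"
      then have "h (r \<otimes> x) = h (\<alpha> j (x \<otimes> u))" by simp
      then show False using fh p_ge_3 by (simp add: h_mult h_\<alpha>_type2[OF True])
    qed
    have 2: "r \<otimes> (x \<otimes> u) \<noteq> \<alpha> j x" for j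
    proof
      assume "r \<otimes> (x \<otimes> u) = \<alpha> j x"
      then have "h (r \<otimes> (x \<otimes> u)) = h (\<alpha> j x)" by simp
      then show False using fh p_ge_3 by (simp add: h_mult h_\<alpha>_type2[OF True])
    qed
    obtain k q where q: "s = \<alpha> k q" "q = x \<or> q = x \<otimes> u" using s by (auto simp: X_def X0_def)
    obtain l q' where q': "r \<otimes> s = \<alpha> l q'" "q' = x \<or> q' = x \<otimes> u" using rs by (auto simp: X_def X0_def)
    obtain j where "r \<otimes> q = \<alpha> j q'" using shift[of k q l q'] q q' by auto
    then show False
      using q(2) q'(2) 1 2 \<tau>_mult_x_notin_orbit[OF r] \<tau>_mult_xu_notin_orbit[OF r True] by auto
  qed
qed

text \<open>The pair (f, h) is (0, 0) on T and (0, 1) on U, and f is 1 on X. Adding values modulo p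
  >= 3 settles everything except T times T, excluded by the chain, and T times X, excluded by
  \<open>T_mult_X\<close>.\<close>

lemma S_product_cases:
  assumes "r \<in> S" "s \<in> S" "r \<otimes> s \<in> S"
  shows "r \<in> T \<and> s \<in> U \<and> r \<otimes> s \<in> U \<or> r \<in> U \<and> s \<in> T \<and> r \<otimes> s \<in> U
       \<or> r \<in> U \<and> s \<in> X \<and> r \<otimes> s \<in> X \<or> r \<in> X \<and> s \<in> U \<and> r \<otimes> s \<in> X"
proof -
  have rc [simp]: "r \<in> carrier G" "s \<in> carrier G" using assms S_closed by auto
  have f: "f (r \<otimes> s) = (f r + f s) mod p" and h: "h (r \<otimes> s) = (h r + h s) mod p"
    by (simp_all add: f_mult h_mult)
  have mods: "(0 + 0) mod p = 0" "(0 + 1) mod p = 1" "(1 + 0) mod p = 1" "(1 + 1) mod p = 2"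
    using p_ge_3 by auto
  have rs: "r \<otimes> s \<in> T \<or> r \<otimes> s \<in> U \<or> r \<otimes> s \<in> X" using assms(3) by (simp add: S_def)
  have T: "a \<in> T \<Longrightarrow> f a = 0" "a \<in> T \<Longrightarrow> h a = 0" and U: "a \<in> U \<Longrightarrow> f a = 0" "a \<in> U \<Longrightarrow> h a = 1"
    and X: "a \<in> X \<Longrightarrow> f a = 1" for a
    using T_D U_D X_D by blast+
  have TT: False if "r \<in> T" "s \<in> T"
  proof -
    have "f (r \<otimes> s) = 0" "h (r \<otimes> s) = 0" using that T f h mods by presburger+
    then have "r \<otimes> s \<in> T" using rs U[of "r \<otimes> s"] X[of "r \<otimes> s"] by linarith
    then show False using that \<tau>_mult_\<tau> unfolding T_def by blast
  qed
  have UU: False if "r \<in> U" "s \<in> U"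
  proof -
    have "f (r \<otimes> s) = 0" "h (r \<otimes> s) = 2" using that U f h mods by presburger+
    then show False using rs T[of "r \<otimes> s"] U[of "r \<otimes> s"] X[of "r \<otimes> s"] by linarith
  qed
  have XX: False if "r \<in> X" "s \<in> X"
  proof -
    have "f (r \<otimes> s) = 2" using that X f mods by presburger
    then show False using rs T[of "r \<otimes> s"] U[of "r \<otimes> s"] X[of "r \<otimes> s"] by linarith
  qed
  have TU: "r \<otimes> s \<in> U" if "r \<in> T \<and> s \<in> U \<or> r \<in> U \<and> s \<in> T"
  proof -
    have "f (r \<otimes> s) = 0" "h (r \<otimes> s) = 1" using that T U f h mods by presburger+
    then show ?thesis using rs T[of "r \<otimes> s"] X[of "r \<otimes> s"] by linarith
  qed
  have X_in: "r \<otimes> s \<in> X" if "r \<notin> X \<and> s \<in> X \<or> r \<in> X \<and> s \<notin> X"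
  proof -
    have nX: "f a = 0" if "a \<in> S" "a \<notin> X" for a using that T U unfolding S_def by blast
    have "f r = 0 \<and> f s = 1 \<or> f r = 1 \<and> f s = 0"
      using that nX[OF assms(1)] nX[OF assms(2)] X[of r] X[of s] by blast
    then have "f (r \<otimes> s) = 1" using f mods by presburger
    then show ?thesis using rs T[of "r \<otimes> s"] U[of "r \<otimes> s"] by linarith
  qed
  have TX: "\<not> (r \<in> T \<and> s \<in> X)" "\<not> (r \<in> X \<and> s \<in> T)"
    using T_mult_X[of r s] T_mult_X[of s r] m_comm[of r s] X_in disjoint by auto
  have "r \<in> T \<or> r \<in> U \<or> r \<in> X" "s \<in> T \<or> s \<in> U \<or> s \<in> X" using assms by (simp_all add: S_def)
  then show ?thesis using TT UU XX TU X_in TX disjoint by blast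
qed

lemma S_product_T: "\<lbrakk>r \<in> T; s \<in> S; r \<otimes> s \<in> S\<rbrakk> \<Longrightarrow> s \<in> U"
  using S_product_cases[of r s] disjoint[of r] by (auto simp: S_def)

lemma \<tau>_mult_L:
  assumes "0 < i" "i \<le> m" "j \<le> m" "s \<in> L j" "l \<le> m" "\<tau> i \<otimes> s \<in> L l"
  shows "i = Suc j \<and> l = i"
proof -
  obtain k n :: nat where kn: "s = u \<otimes> c j \<otimes> z [^] k" "\<tau> i \<otimes> s = u \<otimes> c l \<otimes> z [^] n"
    using assms(4,6) by (auto simp: L_def)
  define k' where "k' = (p - 1) * k"
  have k': "z [^] k \<otimes> z [^] k' = \<one>" unfolding k'_def by (rule z_pow_cancel)
  have [simp]: "\<tau> i \<in> carrier G" using assms \<tau>_closed by auto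
  have "u \<otimes> (\<tau> i \<otimes> c j) \<otimes> (z [^] k \<otimes> z [^] k') = u \<otimes> (c l \<otimes> (z [^] n \<otimes> z [^] k'))"
    using kn(2) assms(3,5) unfolding kn(1) by (simp add: m_ac)
  then have "\<tau> i \<otimes> c j = c l \<otimes> z [^] (n + k')"
    using assms by (simp add: k' nat_pow_mult)
  then show ?thesis using \<tau>_mult_c assms by blast
qed

lemma z_mult_L:
  assumes "s \<in> L j" "j \<le> m" shows "z \<otimes> s \<in> L j" "\<exists>s'\<in>L j. s = z \<otimes> s'"
proof -
  obtain k :: nat where k: "s = u \<otimes> c j \<otimes> z [^] k" using assms(1) by (auto simp: L_def)
  have *: "z \<otimes> (u \<otimes> c j \<otimes> z [^] k) = u \<otimes> c j \<otimes> z [^] Suc k" for k :: nat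
    using assms(2) by (simp add: m_ac)
  then show "z \<otimes> s \<in> L j" unfolding k L_def by blast
  \<comment> \<open>\<open>k + (p - 1)\<close> is the predecessor of k modulo p, available also for
    k = 0.\<close>
  have "z [^] k = z [^] Suc (k + (p - 1))"
    by (rule z_pow_cong) (use p_ge_3 in \<open>simp add: cong_def\<close>)
  then have "s = z \<otimes> (u \<otimes> c j \<otimes> z [^] (k + (p - 1)))" unfolding * k by simp
  then show "\<exists>s'\<in>L j. s = z \<otimes> s'" unfolding L_def by blast
qed

lemma L_disjoint: "\<lbrakk>s \<in> L i; s \<in> L j; i \<le> m; j \<le> m\<rbrakk> \<Longrightarrow> i = j"
  using c_distinct by (auto simp: L_def m_assoc)

lemma \<tau>_mult_L_step:
  assumes "j < m" "s \<in> L j" shows "\<tau> (Suc j) \<otimes> s \<in> L (Suc j)"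
proof -
  obtain k :: nat where k: "s = u \<otimes> c j \<otimes> z [^] k" using assms by (auto simp: L_def)
  have "\<tau> (Suc j) \<otimes> s = u \<otimes> c (Suc j) \<otimes> z [^] k"
    using assms(1) \<tau>_closed[of "Suc j"] by (simp add: k m_ac)
  then show ?thesis unfolding L_def by blast
qed

lemma \<tau>_mult_L_step_inv:
  assumes "j < m" "s \<in> L (Suc j)" shows "\<exists>s'\<in>L j. s = \<tau> (Suc j) \<otimes> s'"
proof -
  obtain k :: nat where k: "s = u \<otimes> c (Suc j) \<otimes> z [^] k" using assms by (auto simp: L_def)
  have "s = \<tau> (Suc j) \<otimes> (u \<otimes> c j \<otimes> z [^] k)"
    using assms(1) \<tau>_closed[of "Suc j"] by (simp add: k m_ac)
  then show ?thesis unfolding L_def by blast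
qed

lemma L_subset: "j \<le> m \<Longrightarrow> L j \<subseteq> U" by (auto simp: U_def)

lemma L_nonempty: "\<exists>s. s \<in> L j" by (auto simp: L_def)

lemma \<tau>_inj: "\<lbrakk>i \<le> m; j \<le> m; \<tau> i = \<tau> j\<rbrakk> \<Longrightarrow> i = j"
  by (metis \<tau>_in_F \<tau>_new linorder_neqE_nat)

subsection \<open>Arcs between out-neighbours of the identity\<close>

text \<open>These are the arcs of the Cayley digraph inside the out-neighbourhood of \<one>
  (\<open>D_iff\<close>), so automorphisms fixing \<one> preserve the relation. The product form
  suits \<open>S_product_cases\<close>.\<close>

definition D :: "'a \<Rightarrow> 'a \<Rightarrow> bool" where
  "D s s' \<longleftrightarrow> s \<in> S \<and> s' \<in> S \<and> (\<exists>r\<in>S. s' = s \<otimes> r)"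

lemma D_E:
  assumes "D s s'"
  obtains r where "r \<in> S" "s \<in> S" "s \<otimes> r \<in> S" "s' = s \<otimes> r"
  using assms unfolding D_def by blast

lemma D_cases:
  assumes "D s s'"
  shows "s \<in> T \<and> s' \<in> U \<or> s \<in> U \<and> s' \<in> U \<or> s \<in> U \<and> s' \<in> X \<or> s \<in> X \<and> s' \<in> X"
  using assms S_product_cases unfolding D_def by blast

text \<open>Multiplication by z permutes each \<open>L j\<close>: s has an arc to z s, and dividing
  s by z stays in U.\<close>

lemma D_U_ex: "s \<in> U \<Longrightarrow> (\<exists>s'\<in>U. D s s') \<and> D z s"
proof -
  assume "s \<in> U"
  then obtain j where j: "j \<le> m" "s \<in> L j" by (auto simp: U_def)
  note zL = z_mult_L[OF j(2,1)]
  have "D s (z \<otimes> s)"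
    unfolding D_def using zL(1) j z_in_T L_subset[OF j(1)] m_comm[of z s] U_D[OF \<open>s \<in> U\<close>]
    by (auto simp: S_def)
  moreover have "z \<otimes> s \<in> U" using zL(1) L_subset j by auto
  moreover have "D z s"
    unfolding D_def using zL(2) \<open>s \<in> U\<close> L_subset[OF j(1)] z_in_T by (auto simp: S_def)
  ultimately show ?thesis by blast
qed

lemma D_T_ex: "s \<in> T \<Longrightarrow> \<exists>s'\<in>U. D s s'"
proof -
  assume s: "s \<in> T"
  then obtain i where i: "s = \<tau> i" "i \<le> m" by (auto simp: T_def)
  show ?thesis
  proof (cases i)
    case 0
    obtain r where "r \<in> L 0" using L_nonempty by blast
    then have "r \<in> U" using L_subset[OF le0] by blast
    then show ?thesis using D_U_ex i 0 \<tau>_0 by auto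
  next
    case (Suc j)
    obtain r where r: "r \<in> L j" using L_nonempty by blast
    then have "s \<otimes> r \<in> U" "r \<in> U" using \<tau>_mult_L_step[of j r] Suc i L_subset[of i] L_subset[of j] by auto
    then show ?thesis using s by (auto simp: D_def S_def)
  qed
qed

lemma D_X0_ex: "s \<in> X0 \<Longrightarrow> \<exists>s'. D s s'"
proof -
  assume "s \<in> X0"
  then obtain k where k: "s = \<alpha> k x" by (auto simp: X0_def)
  have "\<alpha> k u = u \<otimes> c 0 \<otimes> z [^] k" by (simp add: \<alpha>_u)
  then have "\<alpha> k u \<in> L 0" by (auto simp: L_def)
  then have "\<alpha> k u \<in> U" using L_subset[OF le0] by blast
  moreover have "s \<otimes> \<alpha> k u = \<alpha> k (x \<otimes> u)" by (simp add: k \<alpha>_mult)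
  then have "s \<otimes> \<alpha> k u \<in> X" by (auto simp: X_def)
  ultimately show ?thesis using \<open>s \<in> X0\<close> X0_subset by (auto simp: D_def S_def)
qed

text \<open>For e = 1 these targets exhaust X, so X then has no source.\<close>

lemma D_into_orbit: "\<exists>s\<in>X0. D s (\<alpha> k (x \<otimes> u))"
proof -
  have "\<alpha> k u = u \<otimes> c 0 \<otimes> z [^] k" by (simp add: \<alpha>_u)
  then have "\<alpha> k u \<in> L 0" by (auto simp: L_def)
  then have "\<alpha> k u \<in> U" using L_subset[OF le0] by blast
  then have "D (\<alpha> k x) (\<alpha> k (x \<otimes> u))"
    by (auto simp: D_def S_def X_def X0_def \<alpha>_mult)
  then show ?thesis by (auto simp: X0_def)
qed

text \<open>Inside X an arc multiplies by an element of U and so raises h by 1, while h takes only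
  the values 0 and 1 on X.\<close>

lemma D_X_type2:
  assumes e: "e = 0" and D: "D s s'" and s: "s \<in> X"
  shows "h s = 0 \<and> h s' = 1"
proof -
  have sc: "s \<in> carrier G" using X_D[OF s] by simp
  have s': "s' \<in> X" using D_cases[OF D] disjoint s by blast
  obtain r where r: "r \<in> S" "s \<in> S" "s \<otimes> r \<in> S" "s' = s \<otimes> r" using D by (rule D_E)
  have "r \<in> U" using S_product_cases[OF r(2,1,3)] disjoint s by blast
  then have "h s' = (h s + 1) mod p" using r(4) U_D[of r] sc by (simp add: h_mult)
  then show ?thesis using X_h_type2[OF e s] X_h_type2[OF e s'] p_ge_3 by (auto simp: mod_if)
qed

text \<open>For e = 0 the orbit of x u has h = 1 and hence no outgoing arc; for e = 1 there is only
  one orbit.\<close>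

lemma X_nonsink: "s \<in> X \<Longrightarrow> (\<exists>s'. D s s') \<longleftrightarrow> s \<in> X0"
proof -
  assume s: "s \<in> X"
  show ?thesis
  proof (cases "e = 0")
    case True
    have "s \<in> X0" if "D s s'" for s'
    proof (rule ccontr)
      assume "s \<notin> X0"
      then obtain k where "s = \<alpha> k (x \<otimes> u)" using s by (auto simp: X_def)
      then have "h s = 1" by (simp add: h_\<alpha>_type2[OF True])
      then show False using D_X_type2[OF True that s] by simp
    qed
    then show ?thesis using D_X0_ex by blast
  next
    case False
    then show ?thesis using X_type1 e_cases s D_X0_ex by auto
  qed
qed

text \<open>U is excluded because z precedes all of it. X is excluded for e = 1 by having no source,
  and for e = 0 because h can rise only once, so that no path of length two starts there. Each
  clause answers one of the two cases.\<close>

lemma T_char: "s \<in> T \<longleftrightarrow> s \<in> S \<and> (\<forall>r. \<not> D r s) \<and> (\<exists>r q. D s r \<and> D r q)"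
proof
  assume s: "s \<in> T"
  then show "s \<in> S \<and> (\<forall>r. \<not> D r s) \<and> (\<exists>r q. D s r \<and> D r q)"
  proof (intro conjI allI notI)
    show "s \<in> S" using s by (simp add: S_def)
    show False if "D r s" for r using D_cases[OF that] disjoint s by blast
    show "\<exists>r q. D s r \<and> D r q" using D_T_ex[OF s] D_U_ex by blast
  qed
next
  assume s: "s \<in> S \<and> (\<forall>r. \<not> D r s) \<and> (\<exists>r q. D s r \<and> D r q)"
  have "s \<notin> U" using D_U_ex s by blast
  moreover have "s \<notin> X"
  proof
    assume sX: "s \<in> X"
    show False
    proof (cases "e = 0")
      case True
      obtain r q where rq: "D s r" "D r q" using s by blast
      have "r \<in> X" using D_cases[OF rq(1)] disjoint sX by blast
      then show False using D_X_type2[OF True rq(1) sX] D_X_type2[OF True rq(2)] by simp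
    next
      case False
      then have e: "e = 1" using e_cases by auto
      then have "s \<in> X0" using sX X_type1 by blast
      then obtain k where k: "s = \<alpha> k x" unfolding X0_def by blast
      have "\<alpha> (k + (p - 1)) (x \<otimes> u) = \<alpha> (k + p) x"
        unfolding xu_type1[OF e] \<alpha>_add[OF closed(1)] using p_ge_3 by simp
      also have "\<dots> = s" unfolding k \<alpha>_add[OF closed(1), symmetric] by (simp add: \<alpha>_dvd)
      finally show False using D_into_orbit[of "k + (p - 1)"] s by auto
    qed
  qed
  ultimately show "s \<in> T" using s by (auto simp: S_def)
qed

lemma U_char: "s \<in> U \<longleftrightarrow> (\<exists>r\<in>T. D r s)"
proof
  assume "s \<in> U"
  then show "\<exists>r\<in>T. D r s" using D_U_ex z_in_T by blast
next
  assume "\<exists>r\<in>T. D r s"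
  then obtain r where r: "r \<in> T" "D r s" by blast
  show "s \<in> U" using D_cases[OF r(2)] disjoint[of r] r(1) by blast
qed

lemma X_char: "s \<in> X \<longleftrightarrow> s \<in> S \<and> s \<notin> T \<and> s \<notin> U"
  using disjoint[of s] unfolding S_def by blast

lemma X0_char: "s \<in> X0 \<longleftrightarrow> s \<in> S \<and> s \<notin> T \<and> s \<notin> U \<and> (\<exists>r. D s r)"
  using X_nonsink[of s] X0_subset X_char[of s] by blast

text \<open>An arc out of \<open>\<tau> i\<close> multiplies by an element of U, and
  \<open>\<tau>_mult_L\<close> permits only the step from \<open>L (i - 1)\<close> to
  \<open>L i\<close>.\<close>

lemma D_\<tau>_L:
  assumes "0 < i" "i \<le> m" "j \<le> m" "s \<in> L j"
  shows "D (\<tau> i) s \<longleftrightarrow> j = i"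
proof
  assume D: "D (\<tau> i) s"
  then obtain r where r: "r \<in> S" "\<tau> i \<otimes> r \<in> S" "s = \<tau> i \<otimes> r" using D_E by blast
  have "r \<in> U" by (rule S_product_T[OF \<tau>_in_T[OF assms(2)] r(1,2)])
  then obtain l where "l \<le> m" "r \<in> L l" by (auto simp: U_def)
  then show "j = i" using \<tau>_mult_L[of i l r j] assms r(3) by simp
next
  assume "j = i"
  then obtain i' where i': "i = Suc i'" "j = Suc i'" using assms by (cases i) auto
  then obtain s' where "s' \<in> L i'" "s = \<tau> i \<otimes> s'" using \<tau>_mult_L_step_inv[of i' s] assms by auto
  then show "D (\<tau> i) s"
    using assms \<tau>_in_T L_subset[of i'] L_subset[of j] i' by (auto simp: D_def S_def)
qed

text \<open>For i > 0 the arcs from \<open>\<tau> i\<close> end in \<open>L i\<close> and miss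
  \<open>L 0\<close>.\<close>

lemma z_char: "s = z \<longleftrightarrow> s \<in> T \<and> (\<forall>r\<in>U. D s r)"
proof
  assume s: "s \<in> T \<and> (\<forall>r\<in>U. D s r)"
  then obtain i where i: "s = \<tau> i" "i \<le> m" by (auto simp: T_def)
  obtain r where r: "r \<in> L 0" using L_nonempty by blast
  then have "D s r" using s L_subset[OF le0] by auto
  then have "i = 0" using D_\<tau>_L[of i 0 r] i r by auto
  then show "s = z" using i \<tau>_0 by simp
qed (use z_in_T D_U_ex in auto)

text \<open>For j > 0 the coset \<open>L j\<close> receives arcs from \<open>\<tau> j\<close>, which
  differs from z; \<open>L 0\<close> has no such predecessor.\<close>

lemma L_0_char: "s \<in> L 0 \<longleftrightarrow> s \<in> U \<and> (\<forall>r\<in>T. D r s \<longrightarrow> r = z)"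
proof
  assume s: "s \<in> L 0"
  show "s \<in> U \<and> (\<forall>r\<in>T. D r s \<longrightarrow> r = z)"
  proof (intro conjI ballI impI)
    show "s \<in> U" using s L_subset[OF le0] by blast
    fix r assume "r \<in> T" "D r s"
    then obtain i where i: "r = \<tau> i" "i \<le> m" by (auto simp: T_def)
    then have "i = 0" using D_\<tau>_L[of i 0 s] s \<open>D r s\<close> by auto
    then show "r = z" using i \<tau>_0 by simp
  qed
next
  assume s: "s \<in> U \<and> (\<forall>r\<in>T. D r s \<longrightarrow> r = z)"
  then obtain j where j: "j \<le> m" "s \<in> L j" by (auto simp: U_def)
  have "j = 0"
  proof (rule ccontr)
    assume "j \<noteq> 0"
    then have "\<tau> j = z" using D_\<tau>_L[of j j s] j s \<tau>_in_T[of j] by auto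
    then show False using \<tau>_inj[of j 0] \<tau>_0 j \<open>j \<noteq> 0\<close> by simp
  qed
  then show "s \<in> L 0" using j by simp
qed

text \<open>An arc inside U multiplies by some \<open>\<tau> n\<close>: z keeps the coset, and any
  other member of T can only advance it by one.\<close>

lemma D_L_L:
  assumes "i \<le> m" "j \<le> m" "s \<in> L i" "s' \<in> L j" "D s s'"
  shows "j = i \<or> j = Suc i"
proof -
  obtain r where r: "r \<in> S" "s \<in> S" "s \<otimes> r \<in> S" "s' = s \<otimes> r" using assms(5) by (rule D_E)
  have sU: "s \<in> U" "s' \<in> U" using assms(3,4) L_subset[OF assms(1)] L_subset[OF assms(2)] by blast+
  then have "r \<in> T" using S_product_cases[OF r(2,1,3)] disjoint(3) disjoint(1) r(4) by blast
  then obtain n where n: "r = \<tau> n" "n \<le> m" by (auto simp: T_def)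
  have rs: "s' = r \<otimes> s" using r m_comm[OF S_closed S_closed] by simp
  show ?thesis
  proof (cases n)
    case 0
    then have "s' \<in> L i" using rs n z_mult_L assms \<tau>_0 by auto
    then show ?thesis using L_disjoint assms by blast
  next
    case (Suc k)
    then show ?thesis using \<tau>_mult_L[of n i s j] assms rs n by auto
  qed
qed

text \<open>Lets the cosets be recovered one after another from \<open>L 0\<close> by arcs alone,
  which drives the induction in \<open>stab_L\<close>.\<close>

lemma L_Suc_char:
  assumes "Suc i \<le> m"
  shows "s \<in> L (Suc i) \<longleftrightarrow> s \<in> U \<and> s \<notin> L i \<and> (\<exists>r\<in>L i. D r s)"
proof
  assume s: "s \<in> L (Suc i)"
  then obtain r where r: "r \<in> L i" "s = \<tau> (Suc i) \<otimes> r" using \<tau>_mult_L_step_inv[of i s] assms by auto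
  have "r \<in> U" "s \<in> U" using r s L_subset[of i] L_subset[of "Suc i"] assms by auto
  moreover have "s = r \<otimes> \<tau> (Suc i)" using r m_comm \<open>r \<in> U\<close> U_D \<tau>_closed assms by auto
  ultimately have "D r s" using \<tau>_in_T[OF assms] by (auto simp: D_def S_def)
  then show "s \<in> U \<and> s \<notin> L i \<and> (\<exists>r\<in>L i. D r s)"
    using r \<open>s \<in> U\<close> L_disjoint[of s i "Suc i"] s assms by auto
next
  assume s: "s \<in> U \<and> s \<notin> L i \<and> (\<exists>r\<in>L i. D r s)"
  then obtain j where "j \<le> m" "s \<in> L j" by (auto simp: U_def)
  then show "s \<in> L (Suc i)" using s D_L_L[of i j _ s] assms by auto
qed

lemma \<tau>_Suc_char:
  assumes "Suc i \<le> m"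
  shows "s = \<tau> (Suc i) \<longleftrightarrow> s \<in> T \<and> s \<noteq> z \<and> (\<exists>r\<in>L (Suc i). D s r)"
proof
  assume s: "s = \<tau> (Suc i)"
  obtain r where r: "r \<in> L (Suc i)" using L_nonempty by blast
  then have "D s r" using D_\<tau>_L[of "Suc i" "Suc i" r] s assms by auto
  then show "s \<in> T \<and> s \<noteq> z \<and> (\<exists>r\<in>L (Suc i). D s r)"
    using s r \<tau>_in_T assms \<tau>_inj[of "Suc i" 0] \<tau>_0 by auto
next
  assume s: "s \<in> T \<and> s \<noteq> z \<and> (\<exists>r\<in>L (Suc i). D s r)"
  then obtain j where j: "s = \<tau> j" "j \<le> m" "j \<noteq> 0" using \<tau>_0 by (auto simp: T_def)
  then show "s = \<tau> (Suc i)" using D_\<tau>_L[of j "Suc i"] s assms by auto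
qed

text \<open>By independence of y and z, \<open>\<alpha> j x\<close> stays in x <z> only if p divides
  j. For e = 0 the orbit of x u is kept away by h.\<close>

lemma X_mult_z:
  assumes "x \<otimes> z [^] (k::nat) \<in> X"
  shows "z [^] k = \<one>"
proof -
  have *: ?thesis if "x \<otimes> z [^] k = \<alpha> j x" for j
  proof -
    have "z [^] k = y [^] j \<otimes> z [^] ((j choose 2) * e)"
      using that by (simp add: \<alpha>_x m_assoc)
    moreover define n where "n = (p - 1) * ((j choose 2) * e)"
    have "z [^] ((j choose 2) * e) \<otimes> z [^] n = \<one>" unfolding n_def by (rule z_pow_cancel)
    ultimately have "y [^] j = z [^] k \<otimes> z [^] n" by (simp add: m_assoc)
    then have "y [^] j = z [^] (k + n)" by (simp add: nat_pow_mult)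
    then have "p dvd j" by (rule independent)
    then show ?thesis using that \<alpha>_dvd by simp
  qed
  show ?thesis
  proof (cases "e = 0")
    case False
    then have "X = X0" using e_cases X_type1 by blast
    then show ?thesis using assms * unfolding X0_def by blast
  next
    case True
    have "x \<otimes> z [^] k \<noteq> \<alpha> j (x \<otimes> u)" for j
    proof
      assume "x \<otimes> z [^] k = \<alpha> j (x \<otimes> u)"
      then have "h (x \<otimes> z [^] k) = h (\<alpha> j (x \<otimes> u))" by simp
      then show False by (simp add: h_\<alpha>_type2[OF True] h_mult h_pow)
    qed
    then show ?thesis using assms * by (auto simp: X_def X0_def)
  qed
qed

text \<open>For e = 1 the element is the image under \<alpha> of \<open>x \<otimes> z [^] k\<close>,
  because \<alpha> fixes z, so \<open>X_mult_z\<close> applies. For e = 0 only the orbit of x u has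
  the right h, and independence is used again.\<close>

lemma X_mult_uz:
  assumes "x \<otimes> u \<otimes> z [^] (k::nat) \<in> X"
  shows "z [^] k = \<one>"
proof (cases "e = 0")
  case False
  then have e: "e = 1" using e_cases by auto
  have "x \<otimes> u \<otimes> z [^] k = \<alpha> 1 (x \<otimes> z [^] k)"
    using xu_type1[OF e] by (simp add: \<alpha>_mult) (simp add: \<alpha>_fixed f_pow h_pow)
  then obtain j where j: "\<alpha> 1 (x \<otimes> z [^] k) = \<alpha> j x"
    using assms X_type1[OF e] unfolding X0_def by auto
  obtain k' where k': "\<alpha> k' (\<alpha> 1 a) = a" if "a \<in> carrier G" for a using \<alpha>_inverse by metis
  have "x \<otimes> z [^] k = \<alpha> k' (\<alpha> 1 (x \<otimes> z [^] k))" by (subst k') auto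
  also have "\<dots> = \<alpha> (k' + j) x" unfolding j by (simp add: \<alpha>_add)
  finally have "x \<otimes> z [^] k \<in> X" by (auto simp: X_def X0_def)
  then show ?thesis by (rule X_mult_z)
next
  case True
  have "x \<otimes> u \<otimes> z [^] k \<noteq> \<alpha> j x" for j
  proof
    assume "x \<otimes> u \<otimes> z [^] k = \<alpha> j x"
    then have "h (x \<otimes> u \<otimes> z [^] k) = h (\<alpha> j x)" by simp
    then show False using p_ge_3 by (simp add: h_\<alpha>_type2[OF True] h_mult h_pow)
  qed
  then obtain j where j: "x \<otimes> u \<otimes> z [^] k = \<alpha> j (x \<otimes> u)" using assms by (auto simp: X_def X0_def)
  have "(x \<otimes> u) \<otimes> z [^] k = (x \<otimes> u) \<otimes> (y [^] j \<otimes> z [^] j)"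
    unfolding j by (rule \<alpha>_xu_type2[OF True])
  then have "z [^] k = y [^] j \<otimes> z [^] j" by (subst (asm) Units_l_cancel) auto
  then have "y [^] j = z [^] k \<otimes> z [^] ((p - 1) * j)"
    using z_pow_cancel[of j] by (simp add: m_assoc)
  then have "p dvd j" using independent by (simp add: nat_pow_mult)
  then show ?thesis using j \<alpha>_dvd by simp
qed

subsection \<open>Automorphisms of the Cayley digraph\<close>

abbreviation A :: "('a \<Rightarrow> 'a) set" where "A \<equiv> digraph_automorphisms (Cay G S)"

lemma A_I:
  assumes "a \<in> extensional (carrier G)" "bij_betw a (carrier G) (carrier G)"
    "\<And>v w. \<lbrakk>v \<in> carrier G; w \<in> carrier G\<rbrakk> \<Longrightarrow> w \<otimes> inv v \<in> S \<longleftrightarrow> a w \<otimes> inv (a v) \<in> S"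
  shows "a \<in> A"
proof -
  have "a v \<in> carrier G" if "v \<in> carrier G" for v using assms(2) that bij_betwE by blast
  then show ?thesis
    using assms by (auto simp: digraph_automorphisms_def Cay_def Bij_def)
qed

lemma A_D:
  assumes "a \<in> A"
  shows "a \<in> extensional (carrier G)" "bij_betw a (carrier G) (carrier G)"
    "v \<in> carrier G \<Longrightarrow> a v \<in> carrier G"
    "\<lbrakk>v \<in> carrier G; w \<in> carrier G\<rbrakk> \<Longrightarrow> a w \<otimes> inv (a v) \<in> S \<longleftrightarrow> w \<otimes> inv v \<in> S"
proof -
  show ext: "a \<in> extensional (carrier G)" and b: "bij_betw a (carrier G) (carrier G)"
    using assms by (auto simp: digraph_automorphisms_def Cay_def Bij_def)
  show mem: "a v \<in> carrier G" if "v \<in> carrier G" for v using b that bij_betwE by blast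
  show "\<lbrakk>v \<in> carrier G; w \<in> carrier G\<rbrakk> \<Longrightarrow> a w \<otimes> inv (a v) \<in> S \<longleftrightarrow> w \<otimes> inv v \<in> S"
    using assms mem by (auto simp: digraph_automorphisms_def Cay_def)
qed

lemma A_ext:
  assumes "a \<in> A" "b \<in> A" "\<And>v. v \<in> carrier G \<Longrightarrow> a v = b v"
  shows "a = b"
  by (rule extensionalityI[OF A_D(1)[OF assms(1)] A_D(1)[OF assms(2)] assms(3)])

lemma A_compose:
  assumes "a \<in> A" "b \<in> A"
  shows "compose (carrier G) a b \<in> A"
  by (rule A_I) (use A_D[OF assms(1)] A_D[OF assms(2)] in
      \<open>auto simp: compose_def intro: bij_betw_trans[unfolded comp_def]\<close>)

lemma translate_quotient:
  "\<lbrakk>g \<in> carrier G; v \<in> carrier G; w \<in> carrier G\<rbrakk> \<Longrightarrow> (g \<otimes> w) \<otimes> inv (g \<otimes> v) = w \<otimes> inv v"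
  by (simp add: inv_mult m_ac) (metis inv_closed inv_solve_left m_closed m_lcomm)

lemma translation_in_A:
  assumes g: "g \<in> carrier G"
  shows "(\<lambda>v\<in>carrier G. g \<otimes> v) \<in> A"
proof (rule A_I)
  show "bij_betw (\<lambda>v\<in>carrier G. g \<otimes> v) (carrier G) (carrier G)"
    by (rule bij_betw_byWitness[where f' = "\<lambda>v. inv g \<otimes> v"]) (auto simp: g m_assoc[symmetric])
qed (auto simp: translate_quotient g)

text \<open>\<open>a\<close> between two left translations, which are automorphisms because G is
  abelian. The result fixes \<one>, so whatever holds for the stabilizer of \<one> can be used at
  every vertex g.\<close>

definition shift :: "('a \<Rightarrow> 'a) \<Rightarrow> 'a \<Rightarrow> 'a \<Rightarrow> 'a" where
  "shift a g = (\<lambda>v\<in>carrier G. inv (a g) \<otimes> a (g \<otimes> v))"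

lemma shift_in_A:
  assumes a: "a \<in> A" and g: "g \<in> carrier G"
  shows "shift a g \<in> A" "shift a g \<one> = \<one>"
proof -
  have ag: "a g \<in> carrier G" using A_D(3) assms by blast
  have "shift a g = compose (carrier G) (\<lambda>v\<in>carrier G. inv (a g) \<otimes> v)
      (compose (carrier G) a (\<lambda>v\<in>carrier G. g \<otimes> v))"
    using A_D(3)[OF a] g by (auto simp: shift_def compose_def fun_eq_iff)
  then show "shift a g \<in> A" using A_compose translation_in_A a g ag by auto
  show "shift a g \<one> = \<one>" using g ag by (simp add: shift_def)
qed

lemma shift_apply:
  assumes "a \<in> A" "g \<in> carrier G" "v \<in> carrier G"
  shows "a (g \<otimes> v) = a g \<otimes> shift a g v"
  using assms A_D(3)[OF assms(1)] by (simp add: shift_def m_assoc[symmetric])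

lemma D_iff: "D s s' \<longleftrightarrow> s \<in> S \<and> s' \<in> S \<and> s' \<otimes> inv s \<in> S"
proof -
  have "(\<exists>r\<in>S. s' = s \<otimes> r) \<longleftrightarrow> s' \<otimes> inv s \<in> S" if "s \<in> S" "s' \<in> S"
  proof -
    have c [simp]: "s \<in> carrier G" "s' \<in> carrier G" using that S_closed by auto
    have "s' = s \<otimes> (s' \<otimes> inv s)" using m_lcomm[of s s' "inv s"] by simp
    moreover have "s' \<otimes> inv s = r" if "s' = s \<otimes> r" "r \<in> S" for r
      using that S_closed[of r] by (simp add: m_comm[of s r] m_assoc)
    ultimately show ?thesis by (intro iffI) (auto intro: bexI[of _ "s' \<otimes> inv s"])
  qed
  then show ?thesis unfolding D_def by blast
qed

lemma D_carrier: "D s s' \<Longrightarrow> s \<in> carrier G" "D s s' \<Longrightarrow> s' \<in> carrier G"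
  by (auto simp: D_def S_closed)

section \<open>Automorphisms fixing the identity preserve the parts of S\<close>

context
  fixes a assumes a: "a \<in> A" and a1: "a \<one> = \<one>"
begin

lemma stab_closed: "v \<in> carrier G \<Longrightarrow> a v \<in> carrier G"
  using A_D(3)[OF a] by blast

lemma stab_surj:
  assumes "w \<in> carrier G" obtains v where "v \<in> carrier G" "w = a v"
  using A_D(2)[OF a] assms by (auto simp: bij_betw_def)

lemma stab_S: "s \<in> carrier G \<Longrightarrow> a s \<in> S \<longleftrightarrow> s \<in> S"
  using A_D(4)[OF a, of \<one> s] a1 stab_closed by simp

lemma stab_D: "\<lbrakk>s \<in> carrier G; s' \<in> carrier G\<rbrakk> \<Longrightarrow> D (a s) (a s') \<longleftrightarrow> D s s'"
  unfolding D_iff using stab_S A_D(4)[OF a] by simp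

text \<open>Change of variable along the bijection \<open>a\<close>; it transports the existential
  characterizations of T, U, X0 and the cosets.\<close>

lemma stab_ex:
  assumes "\<And>r. r \<in> carrier G \<Longrightarrow> P (a r) \<longleftrightarrow> Q r"
    "\<And>r. P r \<Longrightarrow> r \<in> carrier G" "\<And>r. Q r \<Longrightarrow> r \<in> carrier G"
  shows "(\<exists>r. P r) \<longleftrightarrow> (\<exists>r. Q r)"
proof
  assume "\<exists>r. P r"
  then obtain r where r: "P r" by blast
  obtain r' where "r' \<in> carrier G" "r = a r'" using stab_surj[OF assms(2)[OF r]] by blast
  then show "\<exists>r. Q r" using r assms(1) by blast
next
  assume "\<exists>r. Q r"
  then show "\<exists>r. P r" using assms by blast
qed

lemma stab_T:
  assumes s: "s \<in> carrier G"
  shows "a s \<in> T \<longleftrightarrow> s \<in> T"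
proof -
  have 1: "(\<exists>r. D r (a s)) \<longleftrightarrow> (\<exists>r. D r s)"
    by (rule stab_ex) (auto simp: stab_D s D_carrier)
  have 2: "(\<exists>q. D (a r) q) \<longleftrightarrow> (\<exists>q. D r q)" if "r \<in> carrier G" for r
    by (rule stab_ex) (auto simp: stab_D that D_carrier)
  have "(\<exists>r. D (a s) r \<and> (\<exists>q. D r q)) \<longleftrightarrow> (\<exists>r. D s r \<and> (\<exists>q. D r q))"
    by (rule stab_ex) (auto simp: stab_D 2 s D_carrier)
  then show ?thesis unfolding T_char using 1 stab_S[OF s] by blast
qed

lemma stab_U:
  assumes s: "s \<in> carrier G"
  shows "a s \<in> U \<longleftrightarrow> s \<in> U"
proof -
  have "(\<exists>r. r \<in> T \<and> D r (a s)) \<longleftrightarrow> (\<exists>r. r \<in> T \<and> D r s)"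
    by (rule stab_ex) (auto simp: stab_D stab_T s D_carrier)
  then show ?thesis unfolding U_char by blast
qed

lemma stab_X: "s \<in> carrier G \<Longrightarrow> a s \<in> X \<longleftrightarrow> s \<in> X"
  unfolding X_char using stab_S stab_T stab_U by simp

lemma stab_X0:
  assumes s: "s \<in> carrier G"
  shows "a s \<in> X0 \<longleftrightarrow> s \<in> X0"
proof -
  have "(\<exists>q. D (a s) q) \<longleftrightarrow> (\<exists>q. D s q)"
    by (rule stab_ex) (auto simp: stab_D s D_carrier)
  then show ?thesis unfolding X0_char using stab_S stab_T stab_U s by simp
qed

lemma stab_z: "a z = z"
proof -
  have "D (a z) r" if r: "r \<in> U" for r
  proof -
    have "r \<in> carrier G" using U_D[OF r] by simp
    then obtain r' where r': "r' \<in> carrier G" "r = a r'" by (rule stab_surj)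
    then have "r' \<in> U" using stab_U r by simp
    then show ?thesis using D_U_ex r' stab_D by simp
  qed
  moreover have "a z \<in> T" using stab_T z_in_T by simp
  ultimately show ?thesis using z_char by blast
qed

lemma stab_L_0:
  assumes s: "s \<in> carrier G"
  shows "a s \<in> L 0 \<longleftrightarrow> s \<in> L 0"
proof -
  have z: "a r = z \<longleftrightarrow> r = z" if "r \<in> carrier G" for r
    using A_D(2)[OF a] that stab_z by (metis bij_betw_def inj_on_def closed(4))
  have "(\<exists>r. r \<in> T \<and> D r (a s) \<and> r \<noteq> z) \<longleftrightarrow> (\<exists>r. r \<in> T \<and> D r s \<and> r \<noteq> z)"
    by (rule stab_ex) (auto simp: stab_D stab_T s D_carrier z)
  then show ?thesis unfolding L_0_char using stab_U[OF s] by blast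
qed

lemma stab_L: "\<lbrakk>j \<le> m; s \<in> carrier G\<rbrakk> \<Longrightarrow> a s \<in> L j \<longleftrightarrow> s \<in> L j"
proof (induction j arbitrary: s)
  case 0
  then show ?case by (intro stab_L_0)
next
  case (Suc j)
  have IH: "a s \<in> L j \<longleftrightarrow> s \<in> L j" if "s \<in> carrier G" for s
    using Suc that by simp
  have "(\<exists>r. r \<in> L j \<and> D r (a s)) \<longleftrightarrow> (\<exists>r. r \<in> L j \<and> D r s)"
    by (rule stab_ex) (auto simp: stab_D IH Suc.prems D_carrier)
  then show ?case
    unfolding L_Suc_char[OF Suc.prems(1)] using stab_U IH Suc.prems(2) by blast
qed

text \<open>The purpose of the chain of cosets: \<open>\<tau> (Suc j)\<close> is singled out in T by
  its arcs into the preserved set \<open>L (Suc j)\<close>, so T is fixed pointwise and not merely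
  as a set.\<close>

lemma stab_\<tau>: "i \<le> m \<Longrightarrow> a (\<tau> i) = \<tau> i"
proof (cases i)
  case 0
  then show ?thesis using \<tau>_0 stab_z by simp
next
  case (Suc j)
  assume "i \<le> m"
  then have j: "Suc j \<le> m" using Suc by simp
  have c: "\<tau> (Suc j) \<in> carrier G" using \<tau>_closed j by simp
  from \<tau>_Suc_char[OF j, of "\<tau> (Suc j)"] obtain r where
    r: "\<tau> (Suc j) \<in> T" "\<tau> (Suc j) \<noteq> z" "r \<in> L (Suc j)" "D (\<tau> (Suc j)) r" by blast
  have rc: "r \<in> carrier G" using D_carrier r by blast
  have "a (\<tau> (Suc j)) \<noteq> z"
    using A_D(2)[OF a] stab_z r(2) c by (metis bij_betw_def inj_on_def closed(4))
  moreover have "a (\<tau> (Suc j)) \<in> T" using stab_T r(1) c by simp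
  moreover have "a r \<in> L (Suc j)" using stab_L[OF j rc] r(3) by simp
  moreover have "D (a (\<tau> (Suc j))) (a r)" using stab_D[OF c rc] r(4) by simp
  ultimately show ?thesis using \<tau>_Suc_char[OF j] Suc by blast
qed

end

text \<open>Every \<open>shift a g\<close> fixes every \<open>\<tau> i\<close>, so \<open>a\<close>
  commutes with multiplication by \<open>\<tau> i\<close> at all vertices; the
  \<open>\<tau> i\<close> generate the common kernel.\<close>

lemma A_kernel_equivariant:
  assumes a: "a \<in> A" and n: "n \<in> carrier G" "f n = 0" "h n = 0" and g: "g \<in> carrier G"
  shows "a (g \<otimes> n) = a g \<otimes> n"
proof -
  have "n \<in> generate G (\<tau> ` {..m})" using n \<tau>_generate by simp
  then have "n \<in> carrier G \<and> (\<forall>g\<in>carrier G. a (g \<otimes> n) = a g \<otimes> n)"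
  proof (induction rule: generate.induct)
    case one
    then show ?case using A_D(3)[OF a] by simp
  next
    case (incl t)
    then obtain i where i: "t = \<tau> i" "i \<le> m" by auto
    then have t: "t \<in> carrier G" using \<tau>_closed by simp
    have "a (g \<otimes> t) = a g \<otimes> t" if "g \<in> carrier G" for g
      using shift_apply[OF a that t] stab_\<tau>[OF shift_in_A[OF a that]] i by simp
    then show ?case using t by blast
  next
    case (inv t)
    then obtain i where i: "t = \<tau> i" "i \<le> m" by auto
    then have t [simp]: "t \<in> carrier G" using \<tau>_closed by simp
    have "a (g \<otimes> inv t) = a g \<otimes> inv t" if [simp]: "g \<in> carrier G" for g
    proof -
      have g': "g \<otimes> inv t \<in> carrier G" by simp
      \<comment> \<open>The inverse of a generator is handled by the generator itself, applied at
        the vertex \<open>g \<otimes> inv t\<close>.\<close>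
      have "a ((g \<otimes> inv t) \<otimes> t) = a (g \<otimes> inv t) \<otimes> t"
        using shift_apply[OF a g' t] stab_\<tau>[OF shift_in_A[OF a g']] i by simp
      then have "a g = a (g \<otimes> inv t) \<otimes> t" by (simp add: m_assoc)
      then show ?thesis using A_D(3)[OF a] by (simp add: m_assoc)
    qed
    then show ?case by simp
  next
    case (eng s t)
    then have [simp]: "s \<in> carrier G" "t \<in> carrier G" by auto
    have "a (g \<otimes> (s \<otimes> t)) = a g \<otimes> (s \<otimes> t)" if [simp]: "g \<in> carrier G" for g
    proof -
      have "a (g \<otimes> (s \<otimes> t)) = a ((g \<otimes> s) \<otimes> t)" by (simp add: m_assoc)
      also have "\<dots> = a (g \<otimes> s) \<otimes> t" using eng by simp
      also have "\<dots> = (a g \<otimes> s) \<otimes> t" using eng by simp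
      finally show ?thesis using A_D(3)[OF a] by (simp add: m_assoc)
    qed
    then show ?case by simp
  qed
  then show ?thesis using g by blast
qed

lemma A_mult_u:
  assumes a: "a \<in> A" and g: "g \<in> carrier G"
  obtains k :: nat where "a (g \<otimes> u) = a g \<otimes> (u \<otimes> z [^] k)"
proof -
  have "u = u \<otimes> c 0 \<otimes> z [^] (0::nat)" by simp
  then have "u \<in> L 0" unfolding L_def by blast
  then have "shift a g u \<in> L 0" using stab_L_0[OF shift_in_A[OF a g]] by simp
  then obtain k :: nat where "shift a g u = u \<otimes> z [^] k" by (auto simp: L_def)
  then show thesis using shift_apply[OF a g] that by simp
qed

section \<open>Automorphisms fixing the identity are powers of \<alpha>\<close>

definition \<alpha>_aut :: "nat \<Rightarrow> 'a \<Rightarrow> 'a" where "\<alpha>_aut k = (\<lambda>v\<in>carrier G. \<alpha> k v)"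

lemma \<alpha>_S:
  assumes "s \<in> S" shows "\<alpha> k s \<in> S"
proof -
  consider "s \<in> T" | "s \<in> U" | "s \<in> X" using assms by (auto simp: S_def)
  then show ?thesis
  proof cases
    case 1
    then show ?thesis using T_D[OF 1] assms by (simp add: \<alpha>_fixed)
  next
    case 2
    then obtain j and l :: nat where j: "j \<le> m" "s = u \<otimes> c j \<otimes> z [^] l" by (auto simp: U_def L_def)
    have "\<alpha> k s = \<alpha> k u \<otimes> \<alpha> k (c j) \<otimes> \<alpha> k (z [^] l)" using j by (simp add: \<alpha>_mult)
    also have "\<dots> = u \<otimes> z [^] k \<otimes> c j \<otimes> z [^] l"
      using c_D[OF j(1)] j(1) by (simp add: \<alpha>_u \<alpha>_fixed f_pow h_pow)
    also have "\<dots> = u \<otimes> c j \<otimes> z [^] (k + l)" using j(1) by (simp add: m_ac nat_pow_mult[symmetric])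
    finally show ?thesis using j(1) by (auto simp: S_def U_def L_def)
  next
    case 3
    then obtain q l where "s = \<alpha> l q" "q = x \<or> q = x \<otimes> u" by (auto simp: X_def X0_def)
    then show ?thesis by (auto simp: \<alpha>_add S_def X_def X0_def)
  qed
qed

lemma \<alpha>_inv: "v \<in> carrier G \<Longrightarrow> \<alpha> k (inv v) = inv (\<alpha> k v)"
proof -
  assume v: "v \<in> carrier G"
  have "\<alpha> k (inv v) \<otimes> \<alpha> k v = \<one>" using v by (simp add: \<alpha>_mult[symmetric])
  then show ?thesis using v by (metis \<alpha>_closed inv_closed inv_equality)
qed

lemma \<alpha>_aut_in_A: "\<alpha>_aut k \<in> A"
proof -
  obtain k' where k': "\<And>v. v \<in> carrier G \<Longrightarrow> \<alpha> k' (\<alpha> k v) = v" "\<And>v. v \<in> carrier G \<Longrightarrow> \<alpha> k (\<alpha> k' v) = v"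
    using \<alpha>_inverse[of k] by metis
  show ?thesis
  proof (rule A_I)
    show "bij_betw (\<alpha>_aut k) (carrier G) (carrier G)"
      by (rule bij_betw_byWitness[where f' = "\<alpha> k'"]) (auto simp: \<alpha>_aut_def k')
    show "w \<otimes> inv v \<in> S \<longleftrightarrow> \<alpha>_aut k w \<otimes> inv (\<alpha>_aut k v) \<in> S"
      if [simp]: "v \<in> carrier G" "w \<in> carrier G" for v w
    proof -
      have "\<alpha>_aut k w \<otimes> inv (\<alpha>_aut k v) = \<alpha> k (w \<otimes> inv v)"
        by (simp add: \<alpha>_aut_def \<alpha>_mult \<alpha>_inv)
      moreover have "\<alpha> k (w \<otimes> inv v) \<in> S \<longleftrightarrow> w \<otimes> inv v \<in> S"
        using \<alpha>_S[of "w \<otimes> inv v" k] \<alpha>_S[of "\<alpha> k (w \<otimes> inv v)" k'] k' by auto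
      ultimately show ?thesis by simp
    qed
  qed (simp add: \<alpha>_aut_def)
qed

lemma z_pow_eq_one:
  assumes "z [^] (k::nat) = \<one>" shows "p dvd k"
proof (rule ccontr)
  assume "\<not> p dvd k"
  then have "coprime k p" using prime prime_imp_coprime_nat coprime_commute by blast
  then obtain i where "[k * i = 1] (mod p)" using cong_solve_coprime_nat by auto
  then have "z [^] (k * i) = z [^] (1::nat)" by (rule z_pow_cong)
  moreover have "z [^] (k * i) = \<one>" using assms by (simp add: nat_pow_pow[symmetric])
  ultimately have "z = \<one>" by simp
  then show False using \<tau>_ne_one[of 0] \<tau>_0 by simp
qed

text \<open>The image of x u is computed twice. Starting from x it is x u z^l in X, so z^l = \<one>.
  Starting from u it is u z^k times an element of X; that element must be x z^(-k), so z^k =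
  \<one>.\<close>

lemma stab_x_fixes_u:
  assumes a: "a \<in> A" and a1: "a \<one> = \<one>" and ax: "a x = x"
  shows "a u = u" "a (x \<otimes> u) = x \<otimes> u"
proof -
  obtain k :: nat where k: "a u = u \<otimes> z [^] k" using A_mult_u[OF a one_closed] a1 by auto
  obtain l :: nat where l: "a (x \<otimes> u) = x \<otimes> u \<otimes> z [^] l"
    using A_mult_u[OF a closed(1)] ax by (auto simp: m_assoc)
  have xu: "x \<otimes> u \<in> X"
    using \<alpha>_0[of "x \<otimes> u"] unfolding X_def by (metis UnI2 closed(1,2) m_closed rangeI)
  have x: "x \<in> X" using \<alpha>_0[of x] unfolding X_def X0_def by (metis UnI1 closed(1) rangeI)
  have "a (x \<otimes> u) \<in> X" using stab_X[OF a a1] xu by simp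
  then have "z [^] l = \<one>" unfolding l by (rule X_mult_uz)
  then show axu: "a (x \<otimes> u) = x \<otimes> u" using l by simp
  have "shift a u x \<in> X" using stab_X[OF shift_in_A[OF a closed(2)]] x by simp
  moreover have "a (u \<otimes> x) = (u \<otimes> z [^] k) \<otimes> shift a u x"
    using shift_apply[OF a closed(2) closed(1)] k by simp
  then have eq: "u \<otimes> x = u \<otimes> (z [^] k \<otimes> shift a u x)"
    using axu A_D(3)[OF shift_in_A(1)[OF a closed(2)] closed(1)] by (simp add: m_comm[of x u] m_assoc)
  have sc: "shift a u x \<in> carrier G" using A_D(3)[OF shift_in_A(1)[OF a closed(2)] closed(1)] .
  have x_eq: "x = z [^] k \<otimes> shift a u x" using eq sc by simp
  define k' where "k' = (p - 1) * k"
  have kk: "z [^] k' \<otimes> z [^] k = \<one>" using z_pow_cancel[of k] by (simp add: k'_def m_comm)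
  have "x \<otimes> z [^] k' = (z [^] k' \<otimes> z [^] k) \<otimes> shift a u x"
    using sc by (subst x_eq) (simp add: m_ac)
  then have "x \<otimes> z [^] k' = shift a u x" using kk sc by simp
  ultimately have "z [^] k' = \<one>" using X_mult_z by simp
  then have "z [^] k = \<one>" using kk by simp
  then show "a u = u" using k by simp
qed

text \<open>
  If the automorphism moves \<open>x x\<close> like \<open>\<alpha> k\<close> does relative to \<open>x\<close>, then it also moves \<open>x u\<close> by \<open>z [^] k\<close>;
  since it fixes \<open>x u\<close>, \<open>k\<close> must vanish.
\<close>

lemma stab_x_fixes_x2:
  assumes a: "a \<in> A" and a1: "a \<one> = \<one>" and ax: "a x = x"
  shows "a (x \<otimes> x) = x \<otimes> x"
proof -
  note b = shift_in_A[OF a closed(1)]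
  have "x \<in> X0" using \<alpha>_0[of x] unfolding X0_def by (metis closed(1) rangeI)
  then have "shift a x x \<in> X0" using stab_X0[OF b] by simp
  then obtain k where k: "shift a x x = \<alpha> k x" by (auto simp: X0_def)
  obtain k' where k': "\<And>v. v \<in> carrier G \<Longrightarrow> \<alpha> k' (\<alpha> k v) = v" "\<And>v. v \<in> carrier G \<Longrightarrow> \<alpha> k (\<alpha> k' v) = v"
    using \<alpha>_inverse[of k] by metis
  define b' where "b' = compose (carrier G) (\<alpha>_aut k') (shift a x)"
  have bc: "shift a x v \<in> carrier G" if "v \<in> carrier G" for v using A_D(3)[OF b(1) that] .
  have b': "b' \<in> A" "b' \<one> = \<one>" "b' x = x"
    using A_compose[OF \<alpha>_aut_in_A b(1)] b(2) k k' by (auto simp: b'_def compose_def \<alpha>_aut_def)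
  have "b' u = u" using stab_x_fixes_u[OF b'] by simp
  then have "\<alpha> k' (shift a x u) = u" using bc by (simp add: b'_def compose_def \<alpha>_aut_def)
  then have "shift a x u = \<alpha> k u" using k'(2)[OF bc[OF closed(2)]] by simp
  moreover have "shift a x u = u"
    using shift_apply[OF a closed(1,2)] stab_x_fixes_u(2)[OF a a1 ax] ax bc by simp
  ultimately have "u \<otimes> z [^] k = u" by (simp add: \<alpha>_u)
  then have "z [^] k = \<one>" by simp
  then have "p dvd k" by (rule z_pow_eq_one)
  then have "shift a x x = x" using k \<alpha>_dvd by simp
  then show ?thesis using shift_apply[OF a closed(1,1)] ax by simp
qed

text \<open>\<open>P g\<close> says that \<open>a\<close> fixes g and that \<open>shift a g\<close>
  fixes x, so the preceding lemmas apply at g and carry \<open>P\<close> to g x and g u. This is why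
  x x and x u had to be shown fixed.\<close>

lemma fixes_x_imp_id:
  assumes a: "a \<in> A" and a1: "a \<one> = \<one>" and ax: "a x = x" and v: "v \<in> carrier G"
  shows "a v = v"
proof -
  define P where "P g \<longleftrightarrow> g \<in> carrier G \<and> a g = g \<and> a (g \<otimes> x) = g \<otimes> x" for g
  have step: "P (g \<otimes> x) \<and> P (g \<otimes> u)" if "P g" for g
  proof -
    have g [simp]: "g \<in> carrier G" "a g = g" "a (g \<otimes> x) = g \<otimes> x" using that by (auto simp: P_def)
    note b = shift_in_A[OF a g(1)]
    have bx: "shift a g x = x" using shift_apply[OF a g(1) closed(1)] A_D(3)[OF b(1)] by simp
    note fx = stab_x_fixes_u[OF b bx] stab_x_fixes_x2[OF b bx]
    have "a (g \<otimes> (x \<otimes> x)) = g \<otimes> (x \<otimes> x)" "a (g \<otimes> u) = g \<otimes> u" "a (g \<otimes> (x \<otimes> u)) = g \<otimes> (x \<otimes> u)"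
      using shift_apply[OF a g(1)] fx by simp_all
    then show ?thesis by (simp add: P_def m_assoc m_comm[of u x])
  qed
  have "P \<one>" using a1 ax by (simp add: P_def)
  then have Px: "P (x [^] i)" for i :: nat by (induction i) (use step in auto)
  have *: "P (x [^] i \<otimes> u [^] j)" for i j :: nat
  proof (induction j)
    case 0
    then show ?case using Px by simp
  next
    case (Suc j)
    then show ?case using step[of "x [^] i \<otimes> u [^] j"] by (simp add: m_assoc)
  qed
  \<comment> \<open>A representative of the coset v N: it has the same f and h as v, and
    \<open>a\<close> is already known to fix it.\<close>
  define w where "w = x [^] f v \<otimes> u [^] h v"
  have wc [simp]: "w \<in> carrier G" by (simp add: w_def)
  have fw: "f w = f v" "h w = h v" using v by (simp_all add: w_def f_mult h_mult f_pow h_pow)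
  define n where "n = inv w \<otimes> v"
  have nc: "n \<in> carrier G" using v by (simp add: n_def)
  have v_eq: "v = w \<otimes> n" using v by (simp add: n_def m_assoc[symmetric])
  have "f v = (f v + f n) mod p" "h v = (h v + h n) mod p"
    using f_mult[OF wc nc] h_mult[OF wc nc] fw v_eq by simp_all
  then have "f n = 0" "h n = 0"
    using f_less[OF nc] f_less[OF v] h_less[OF nc] h_less[OF v] by (auto simp: mod_if split: if_splits)
  then have "a (w \<otimes> n) = a w \<otimes> n" using A_kernel_equivariant[OF a nc] by simp
  moreover have "a w = w" using * by (simp add: P_def w_def)
  ultimately show ?thesis using v_eq by simp
qed

text \<open>X0 is preserved and is one \<alpha>-orbit, so some power of \<alpha> agrees with
  \<open>a\<close> at x; undoing it leaves an automorphism that fixes x.\<close>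

lemma stab_eq_\<alpha>:
  assumes a: "a \<in> A" and a1: "a \<one> = \<one>"
  obtains k where "k < p" "\<And>v. v \<in> carrier G \<Longrightarrow> a v = \<alpha> k v"
proof -
  have "x \<in> X0" using \<alpha>_0[of x] unfolding X0_def by (metis closed(1) rangeI)
  then have "a x \<in> X0" using stab_X0[OF a a1] by simp
  then obtain k where k: "a x = \<alpha> k x" by (auto simp: X0_def)
  obtain k' where k': "\<And>v. v \<in> carrier G \<Longrightarrow> \<alpha> k' (\<alpha> k v) = v" "\<And>v. v \<in> carrier G \<Longrightarrow> \<alpha> k (\<alpha> k' v) = v"
    using \<alpha>_inverse[of k] by metis
  define b where "b = compose (carrier G) (\<alpha>_aut k') a"
  have ac: "a v \<in> carrier G" if "v \<in> carrier G" for v using A_D(3)[OF a that] .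
  have b: "b \<in> A" "b \<one> = \<one>" "b x = x"
    using A_compose[OF \<alpha>_aut_in_A a] a1 k k' by (auto simp: b_def compose_def \<alpha>_aut_def)
  have "a v = \<alpha> (k mod p) v" if v: "v \<in> carrier G" for v
  proof -
    have "\<alpha> k' (a v) = v" using fixes_x_imp_id[OF b v] ac v by (simp add: b_def compose_def \<alpha>_aut_def)
    then have "a v = \<alpha> k v" using k'(2)[OF ac[OF v]] by simp
    then show ?thesis using \<alpha>_mod v by simp
  qed
  moreover have "k mod p < p" using p_ge_3 by simp
  ultimately show thesis using that by blast
qed

section \<open>The full automorphism group and the Cayley index\<close>

definition affine :: "'a \<Rightarrow> nat \<Rightarrow> 'a \<Rightarrow> 'a" where
  "affine g k = (\<lambda>v\<in>carrier G. \<alpha> k v \<otimes> g)"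

lemma affine_in_A: "g \<in> carrier G \<Longrightarrow> affine g k \<in> A"
proof -
  assume g: "g \<in> carrier G"
  have "affine g k = compose (carrier G) (\<lambda>v\<in>carrier G. g \<otimes> v) (\<alpha>_aut k)"
    using g by (auto simp: affine_def compose_def \<alpha>_aut_def fun_eq_iff m_comm)
  then show ?thesis using A_compose translation_in_A \<alpha>_aut_in_A g by simp
qed

lemma A_eq_affine: "A = (\<lambda>(g, k). affine g k) ` (carrier G \<times> {..<p})"
proof (intro equalityI subsetI)
  fix a assume a: "a \<in> A"
  have a1: "a \<one> \<in> carrier G" using A_D(3)[OF a] by simp
  obtain k where k: "k < p" "\<And>v. v \<in> carrier G \<Longrightarrow> shift a \<one> v = \<alpha> k v"
    using stab_eq_\<alpha>[OF shift_in_A[OF a one_closed]] by metis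
  have "a = affine (a \<one>) k"
  proof (rule A_ext[OF a affine_in_A[OF a1]])
    fix v assume v: "v \<in> carrier G"
    have "a v = a \<one> \<otimes> shift a \<one> v" using shift_apply[OF a one_closed v] v by simp
    then show "a v = affine (a \<one>) k v" using k(2) v a1 by (simp add: affine_def m_comm)
  qed
  then have "a = (\<lambda>(g, k). affine g k) (a \<one>, k)" unfolding case_prod_conv .
  moreover have "(a \<one>, k) \<in> carrier G \<times> {..<p}" using a1 k(1) by simp
  ultimately show "a \<in> (\<lambda>(g, k). affine g k) ` (carrier G \<times> {..<p})" by (rule image_eqI)
qed (auto simp: affine_in_A)

lemma \<alpha>_x_inj:
  assumes "\<alpha> k x = \<alpha> l x" "k < p" "l < p"
  shows "k = l"
proof -
  have "\<alpha> (l + (p - k)) x = \<alpha> ((p - k) + l) x" by (simp add: add.commute)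
  also have "\<dots> = \<alpha> (p - k) (\<alpha> l x)" by (simp add: \<alpha>_add)
  also have "\<dots> = \<alpha> (p - k + k) x" unfolding assms(1)[symmetric] by (simp only: \<alpha>_add closed)
  also have "\<dots> = x" using assms(2) by (simp add: \<alpha>_dvd)
  finally have eq: "\<alpha> (l + (p - k)) x = x" .
  \<comment> \<open>This stands for l - k shifted by p. It lies strictly between 0 and 2 p, so once
    p divides it, it equals p.\<close>
  define j where "j = l + (p - k)"
  define i where "i = (j choose 2) * e"
  have "x \<otimes> (y [^] j \<otimes> z [^] i) = x" using eq unfolding \<alpha>_x j_def i_def by (simp add: m_assoc)
  then have one: "y [^] j \<otimes> z [^] i = \<one>" by (subst (asm) l_cancel_one) auto
  have "y [^] j = (y [^] j \<otimes> z [^] i) \<otimes> z [^] ((p - 1) * i)"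
    using z_pow_cancel[of i] by (simp add: m_assoc)
  then have "y [^] j = z [^] ((p - 1) * i)" using one by simp
  then have "p dvd j" by (rule independent)
  moreover have "j < 2 * p" "0 < j" using assms by (auto simp: j_def)
  ultimately have "j = p" by (auto elim!: dvdE)
  then show ?thesis using assms by (simp add: j_def)
qed

lemma card_A: "card A = order G * p"
proof -
  have key: "g = g' \<and> k = k'" if kk: "g \<in> carrier G" "g' \<in> carrier G" "k < p" "k' < p"
    and eq: "affine g k = affine g' k'" for g g' k k'
  proof -
    from eq have "affine g k \<one> = affine g' k' \<one>" "affine g k x = affine g' k' x" by simp_all
    then show ?thesis using kk \<alpha>_x_inj by (auto simp: affine_def)
  qed
  have "inj_on (\<lambda>(g, k). affine g k) (carrier G \<times> {..<p})"
    by (rule inj_onI) (use key in auto)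
  then show ?thesis unfolding A_eq_affine by (simp add: card_image card_cartesian_product order_def)
qed

lemma Cayley_index_eq: "Cayley_index G S = p"
proof -
  interpret Aut: group "Aut_digraph (Cay G S)" by (rule group_Aut_digraph)
  have "inj_on (\<lambda>g. \<lambda>v\<in>carrier G. v \<otimes> g) (carrier G)"
  proof (rule inj_onI)
    fix g g' assume g: "g \<in> carrier G" "g' \<in> carrier G"
      and "(\<lambda>v\<in>carrier G. v \<otimes> g) = (\<lambda>v\<in>carrier G. v \<otimes> g')"
    then have "(\<lambda>v\<in>carrier G. v \<otimes> g) \<one> = (\<lambda>v\<in>carrier G. v \<otimes> g') \<one>" by simp
    then show "g = g'" using g by simp
  qed
  then have "card (right_regular G) = order G" by (simp add: right_regular_def card_image order_def)
  moreover have "order (Aut_digraph (Cay G S)) = order G * p"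
    using card_A by (simp add: order_def Aut_digraph_def)
  ultimately have "Cayley_index G S * order G = order G * p"
    unfolding Cayley_index_def using Aut.lagrange[OF subgroup_right_regular] by simp
  then show ?thesis using order_gt_0_iff_finite fin by simp
qed

lemma proper: "proper_digraph (Cay G S)"
proof -
  have "x \<in> S" using \<alpha>_0[of x] unfolding S_def X_def X0_def by (metis UnI1 UnI2 closed(1) rangeI)
  \<comment> \<open>Modulo p, f (inv x) is -1, whereas f is 0 or 1 on S.\<close>
  have "inv x \<notin> S"
  proof
    assume "inv x \<in> S"
    then have "f (inv x) = 0 \<or> f (inv x) = 1" using T_D U_D X_D by (auto simp: S_def)
    moreover have "f (x \<otimes> inv x) = (1 + f (inv x)) mod p" by (subst f_mult) auto
    ultimately show False using p_ge_3 by (auto simp: mod_if)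
  qed
  have ends: "arcs_ends (with_proj (Cay G S)) = parcs (Cay G S)"
    by (auto simp: arcs_ends_def arc_to_ends_def)
  have "(\<one>, x) \<in> parcs (Cay G S)" "(x, \<one>) \<notin> parcs (Cay G S)"
    using \<open>x \<in> S\<close> \<open>inv x \<notin> S\<close> by (auto simp: Cay_def)
  then have "\<not> symmetric (with_proj (Cay G S))"
    unfolding symmetric_def ends sym_def by blast
  then show ?thesis using pair_digraph_Cay[OF fin one_notin_S] by (simp add: proper_digraph_def)
qed

subsection \<open>A nonabelian regular subgroup\<close>

text \<open>Composition yields the twisted product \<open>\<alpha> (f g) g' \<otimes> g\<close>.
  Since f is invariant under \<alpha>, it is still additive for this product, which is what closes
  the set (\<open>R_mult\<close>).\<close>

definition R :: "('a \<Rightarrow> 'a) set" where "R = (\<lambda>g. affine g (f g)) ` carrier G"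

lemma Aut_mult: "\<lbrakk>a \<in> A; b \<in> A\<rbrakk> \<Longrightarrow> a \<otimes>\<^bsub>Aut_digraph (Cay G S)\<^esub> b = compose (carrier G) a b"
  by (simp add: Aut_digraph_def BijGroup_def digraph_automorphisms_def Cay_def)

lemma Aut_one: "\<one>\<^bsub>Aut_digraph (Cay G S)\<^esub> = (\<lambda>v\<in>carrier G. v)"
  by (simp add: Aut_digraph_def BijGroup_def Cay_def)

lemma R_mult:
  assumes "g \<in> carrier G" "g' \<in> carrier G"
  shows "affine g (f g) \<otimes>\<^bsub>Aut_digraph (Cay G S)\<^esub> affine g' (f g')
       = affine (\<alpha> (f g) g' \<otimes> g) (f (\<alpha> (f g) g' \<otimes> g))"
proof -
  have "\<alpha> (f g) (\<alpha> (f g') v \<otimes> g') \<otimes> g = \<alpha> (f (\<alpha> (f g) g' \<otimes> g)) v \<otimes> (\<alpha> (f g) g' \<otimes> g)"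
    if v: "v \<in> carrier G" for v
  proof -
    have "\<alpha> (f (\<alpha> (f g) g' \<otimes> g)) v = \<alpha> (f g + f g') v"
      using assms v \<alpha>_mod[OF v] by (simp add: f_mult add.commute)
    then show ?thesis using assms v by (simp add: \<alpha>_mult \<alpha>_add m_assoc)
  qed
  then show ?thesis
    using assms by (simp add: Aut_mult affine_in_A) (auto simp: compose_def affine_def fun_eq_iff)
qed

lemma R_subgroup: "subgroup R (Aut_digraph (Cay G S))"
proof -
  interpret Aut: group "Aut_digraph (Cay G S)" by (rule group_Aut_digraph)
  have carrier: "carrier (Aut_digraph (Cay G S)) = A" by (simp add: Aut_digraph_def)
  have sub: "R \<subseteq> carrier (Aut_digraph (Cay G S))" by (auto simp: R_def carrier affine_in_A)
  have closed: "a \<otimes>\<^bsub>Aut_digraph (Cay G S)\<^esub> b \<in> R" if "a \<in> R" "b \<in> R" for a b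
    using that by (auto simp: R_def R_mult)
  have one: "\<one>\<^bsub>Aut_digraph (Cay G S)\<^esub> \<in> R"
    unfolding R_def Aut_one by (rule image_eqI[of _ _ \<one>]) (auto simp: affine_def)
  have inv: "inv\<^bsub>Aut_digraph (Cay G S)\<^esub> a \<in> R" if a: "a \<in> R" for a
  proof -
    obtain g where g: "g \<in> carrier G" "a = affine g (f g)" using a by (auto simp: R_def)
    obtain k' where k': "\<And>v. v \<in> carrier G \<Longrightarrow> \<alpha> k' (\<alpha> (f g) v) = v" "\<And>v. v \<in> carrier G \<Longrightarrow> \<alpha> (f g) (\<alpha> k' v) = v"
      using \<alpha>_inverse[of "f g"] by metis
    define g' where "g' = \<alpha> k' (inv g)"
    have g': "g' \<in> carrier G" "\<alpha> (f g) g' = inv g" using g k' by (auto simp: g'_def)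
    define b where "b = affine g' (f g')"
    have b: "b \<in> R" using g' by (auto simp: b_def R_def)
    have "a \<otimes>\<^bsub>Aut_digraph (Cay G S)\<^esub> b = affine \<one> (f \<one>)"
      unfolding g(2) b_def R_mult[OF g(1) g'(1)] using g g' by simp
    then have ab: "a \<otimes>\<^bsub>Aut_digraph (Cay G S)\<^esub> b = \<one>\<^bsub>Aut_digraph (Cay G S)\<^esub>"
      by (simp add: Aut_one) (auto simp: affine_def)
    have mem: "a \<in> carrier (Aut_digraph (Cay G S))" "b \<in> carrier (Aut_digraph (Cay G S))"
      using sub a b by blast+
    have "inv\<^bsub>Aut_digraph (Cay G S)\<^esub> a = b"
      by (rule Aut.inv_equality[OF Aut.inv_comm[OF ab mem] mem])
    then show ?thesis using b by simp
  qed
  show ?thesis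
    by (rule Aut.subgroupI) (use sub one closed inv in auto)
qed

lemma regular_R: "regular_subgroup R (Cay G S)"
proof -
  have V: "pverts (Cay G S) = carrier G" by (simp add: Cay_def)
  interpret Aut: group "Aut_digraph (Cay G S)" by (rule group_Aut_digraph)
  interpret RG: group "(Aut_digraph (Cay G S))\<lparr>carrier := R\<rparr>"
    by (rule Aut.subgroup_imp_group[OF R_subgroup])
  have RB: "a \<in> Bij (carrier G)" if "a \<in> R" for a
  proof -
    have "a \<in> A" using that by (auto simp: R_def affine_in_A)
    then show ?thesis by (auto simp: digraph_automorphisms_def V)
  qed
  have value_one: "affine g k \<one> = g" if "g \<in> carrier G" for g k using that by (simp add: affine_def)
  have ga: "group_action ((Aut_digraph (Cay G S))\<lparr>carrier := R\<rparr>) (carrier G) (\<lambda>a. a)"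
  proof (intro group_action.intro group_hom.intro group_hom_axioms.intro)
    show "group ((Aut_digraph (Cay G S))\<lparr>carrier := R\<rparr>)" by (rule RG.is_group)
    show "group (BijGroup (carrier G))" by (rule group_BijGroup)
    show "(\<lambda>a. a) \<in> hom ((Aut_digraph (Cay G S))\<lparr>carrier := R\<rparr>) (BijGroup (carrier G))"
      by (rule homI) (auto simp: RB BijGroup_def Aut_digraph_def V)
  qed
  \<comment> \<open>Applying f to both images gives f g = f g'; then the same power of \<alpha> acts
    on v and cancels.\<close>
  have unique: "g = g'" if g: "g \<in> carrier G" "g' \<in> carrier G" "v \<in> carrier G"
    "affine g (f g) v = affine g' (f g') v" for g g' v
  proof -
    have eq: "\<alpha> (f g) v \<otimes> g = \<alpha> (f g') v \<otimes> g'" using g by (simp add: affine_def)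
    then have "(f v + f g) mod p = (f v + f g') mod p"
      using g by (metis f_\<alpha> f_mult \<alpha>_closed)
    then have "[f g = f g'] (mod p)"
      using cong_add_lcancel_nat[of "f v" "f g" "f g'" p] by (simp add: cong_def)
    then have "f g = f g'" using f_less g by (simp add: cong_def)
    then show ?thesis using eq g by simp
  qed
  have surj: "\<exists>a\<in>R. a v = w" if v: "v \<in> carrier G" and w: "w \<in> carrier G" for v w
  proof -
    have "inj_on (\<lambda>g. affine g (f g) v) (carrier G)" using unique v by (auto intro: inj_onI)
    moreover have "(\<lambda>g. affine g (f g) v) ` carrier G \<subseteq> carrier G" using v by (auto simp: affine_def)
    ultimately have "(\<lambda>g. affine g (f g) v) ` carrier G = carrier G"
      using fin endo_inj_surj by blast
    with w have "w \<in> (\<lambda>g. affine g (f g) v) ` carrier G" by metis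
    then obtain g where "g \<in> carrier G" "affine g (f g) v = w" by blast
    then show ?thesis unfolding R_def by blast
  qed
  have stab: "stabilizer ((Aut_digraph (Cay G S))\<lparr>carrier := R\<rparr>) (\<lambda>a. a) v = {\<one>\<^bsub>Aut_digraph (Cay G S)\<^esub>}"
    if v: "v \<in> carrier G" for v
  proof (intro equalityI subsetI)
    fix a assume "a \<in> stabilizer ((Aut_digraph (Cay G S))\<lparr>carrier := R\<rparr>) (\<lambda>a. a) v"
    then obtain g where g: "g \<in> carrier G" "a = affine g (f g)" "a v = v"
      by (auto simp: stabilizer_def R_def)
    then have "g = \<one>" using unique[of g \<one> v] v by (simp add: affine_def)
    then show "a \<in> {\<one>\<^bsub>Aut_digraph (Cay G S)\<^esub>}" using g by (auto simp: Aut_one affine_def)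
  next
    fix a assume "a \<in> {\<one>\<^bsub>Aut_digraph (Cay G S)\<^esub>}"
    then show "a \<in> stabilizer ((Aut_digraph (Cay G S))\<lparr>carrier := R\<rparr>) (\<lambda>a. a) v"
      using v subgroup.one_closed[OF R_subgroup] by (auto simp: stabilizer_def Aut_one)
  qed
  have "transitive_action ((Aut_digraph (Cay G S))\<lparr>carrier := R\<rparr>) (carrier G) (\<lambda>a. a)"
    by (intro transitive_action.intro ga transitive_action_axioms.intro) (simp add: surj)
  then show ?thesis unfolding regular_subgroup_def V using R_subgroup stab by blast
qed

text \<open>The twist by f x = 1 turns u into u z, while the twist by f u = 0 leaves x alone, so the
  two composites differ by z at \<one>.\<close>

lemma R_nonabelian: "\<not> comm_group ((Aut_digraph (Cay G S))\<lparr>carrier := R\<rparr>)"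
proof
  assume "comm_group ((Aut_digraph (Cay G S))\<lparr>carrier := R\<rparr>)"
  then interpret C: comm_group "(Aut_digraph (Cay G S))\<lparr>carrier := R\<rparr>" .
  have "affine x (f x) \<in> R" "affine u (f u) \<in> R"
    unfolding R_def by (rule imageI, rule closed)+
  then have "affine x (f x) \<otimes>\<^bsub>Aut_digraph (Cay G S)\<^esub> affine u (f u)
      = affine u (f u) \<otimes>\<^bsub>Aut_digraph (Cay G S)\<^esub> affine x (f x)"
    using C.m_comm[of "affine x (f x)" "affine u (f u)"] by simp
  then have "affine (\<alpha> (f x) u \<otimes> x) (f (\<alpha> (f x) u \<otimes> x)) \<one> = affine (\<alpha> (f u) x \<otimes> u) (f (\<alpha> (f u) x \<otimes> u)) \<one>"
    unfolding R_mult[OF closed(1,2)] R_mult[OF closed(2,1)] by (rule fun_cong)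
  then have "u \<otimes> z \<otimes> x = x \<otimes> u" by (simp add: affine_def \<alpha>_u)
  then have "(u \<otimes> x) \<otimes> z = u \<otimes> x" by (simp add: m_ac)
  then have "z = \<one>" by (simp del: m_assoc)
  then show False using \<tau>_ne_one[of 0] \<tau>_0 by simp
qed

lemma S_witness:
  "S \<subseteq> carrier G \<and> \<one> \<notin> S \<and> proper_digraph (Cay G S) \<and> Cayley_index G S = p \<and>
   (\<exists>R. regular_subgroup R (Cay G S) \<and> \<not> comm_group ((Aut_digraph (Cay G S))\<lparr>carrier := R\<rparr>))"
  using S_closed one_notin_S proper Cayley_index_eq regular_R R_nonabelian by blast

end

subsection \<open>Existence of the construction data\<close>

lemma (in comm_group) exists_cayley_data:
  assumes fin: "finite (carrier G)" and p: "prime p" "odd p" and ord: "order G = p ^ n"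
    and big: "p ^ 3 \<le> order G" and nc: "\<not> cyclic_group G"
  shows "\<exists>f h e x u y z \<tau> m. cayley_data G p f h e x u y z \<tau> m"
proof -
  have p0: "0 < p" and p1: "1 < p" using p prime_gt_0_nat prime_gt_1_nat by blast+
  have oddG: "odd (order G)" using ord p by simp
  have "1 < p ^ 3" using p1 by (rule one_less_power) simp
  then have n: "0 < n" using big ord by (cases n) auto
  have z_root: "z = \<one>" if zk: "z \<in> carrier G" "z [^] p = \<one>" "z [^] k = \<one>" "\<not> p dvd k" for z and k :: nat
  proof -
    obtain i q where iq: "k * i = 1 + p * q" using prime_not_dvd_inverse[OF p(1) zk(4)] by blast
    have "(z [^] k) [^] i = z \<otimes> (z [^] p) [^] q"
      using zk(1) by (simp add: nat_pow_pow iq nat_pow_mult[symmetric] m_comm)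
    then show ?thesis using zk(1-3) by simp
  qed
  show ?thesis
  proof (cases "\<exists>y\<in>carrier G. y [^] p = \<one> \<and> (\<forall>a\<in>carrier G. y \<noteq> a [^] p)")
    case True
    then obtain y where y: "y \<in> carrier G" "y [^] p = \<one>" "\<And>a. a \<in> carrier G \<Longrightarrow> y \<noteq> a [^] p" by blast
    obtain x and f h :: "'a \<Rightarrow> nat" where x: "x \<in> carrier G"
      and f: "functional_mod p f" and h: "functional_mod p h"
      and vals: "f x = 1" "f y = 0" "h x = 0" "h y = 1"
      by (rule independent_functionals[OF fin p(1) ord nc y(1,3)])
    define N where "N = {a \<in> carrier G. f a = 0 \<and> h a = 0}"
    have N: "subgroup N G"
      by (rule subgroupI)
         (auto simp: N_def functional_mod_mult[OF f] functional_mod_mult[OF h] functional_mod_one[OF f p0] functional_mod_one[OF h p0]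
           functional_mod_inv[OF f p0] functional_mod_inv[OF h p0])
    \<comment> \<open>With trivial N the map (f, h) is injective and G has at most p^2 elements;
      here the lower bound on the order is used.\<close>
    have "\<exists>a\<in>N. a \<noteq> \<one>"
    proof (rule ccontr)
      assume triv: "\<not> (\<exists>a\<in>N. a \<noteq> \<one>)"
      have "inj_on (\<lambda>a. (f a, h a)) (carrier G)"
      proof (rule inj_onI)
        fix a b assume ab: "a \<in> carrier G" "b \<in> carrier G" "(f a, h a) = (f b, h b)"
        then have "a \<otimes> inv b \<in> N"
          using functional_mod_eqD[OF f p0] functional_mod_eqD[OF h p0] by (auto simp: N_def)
        then have "a \<otimes> inv b = \<one>" using triv by blast
        then show "a = b" using ab by (metis inv_equality inv_inv inv_closed)
      qed
      then have "card (carrier G) \<le> card ({..<p} \<times> {..<p})"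
        using functional_mod_less[OF f p0] functional_mod_less[OF h p0]
        by (intro card_inj_on_le[of "\<lambda>a. (f a, h a)"]) auto
      then have "order G \<le> p ^ 2" by (simp add: order_def power2_eq_square)
      moreover have "p ^ 2 < p ^ 3" using p1 by (simp add: power_strict_increasing)
      ultimately show False using big by simp
    qed
    then obtain a where a: "a \<in> N" "a \<noteq> \<one>" by blast
    have ac: "a \<in> carrier G" using a by (simp add: N_def)
    obtain j :: nat where j: "a [^] j \<noteq> \<one>" "(a [^] j) [^] p = \<one>"
      using exists_power_of_order_prime[OF ord ac a(2)] by blast
    define z where "z = a [^] j"
    have z: "z \<in> N" "z \<noteq> \<one>" "z [^] p = \<one>"
      using subgroup_nat_pow_closed[OF N a(1)] j by (auto simp: z_def)
    have zc: "z \<in> carrier G" and zv: "f z = 0" "h z = 0" using z by (auto simp: N_def)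
    have "\<exists>\<sigma> (m::nat). 1 \<le> m \<and> (\<forall>i<1. \<sigma> i = z) \<and> generate G (\<sigma> ` {..<m}) = N \<and>
      (\<forall>i<m. \<sigma> i \<in> N \<and> \<sigma> i \<notin> generate G (\<sigma> ` {..<i}))"
      by (rule exists_generating_chain[where \<tau> = "\<lambda>_. z" and k = 1, OF fin N]) (use z in \<open>auto simp: generate_empty\<close>)
    then obtain \<tau> and m :: nat where chain: "1 \<le> m" "\<forall>i<1. \<tau> i = z" "generate G (\<tau> ` {..<m}) = N"
      "\<forall>i<m. \<tau> i \<in> N \<and> \<tau> i \<notin> generate G (\<tau> ` {..<i})" by blast
    then have \<tau>: "1 \<le> m" "\<tau> 0 = z" "generate G (\<tau> ` {..<m}) = N" "\<And>i. i < m \<Longrightarrow> \<tau> i \<in> N"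
      "\<And>i. i < m \<Longrightarrow> \<tau> i \<notin> generate G (\<tau> ` {..<i})" by simp_all
    \<comment> \<open>The chain has m members, whereas the locale takes the last index as its
      parameter, hence \<open>m - 1\<close>.\<close>
    have m: "{..m - 1} = {..<m}" using \<tau>(1) by auto
    have indep: "p dvd k" if eq: "y [^] k = z [^] l" for k l :: nat
    proof -
      have "h (y [^] k) = h (z [^] l)" using eq by simp
      then have "k mod p = 0" using y(1) zc zv vals by (simp add: functional_mod_pow[OF h p0])
      then show ?thesis by auto
    qed
    have \<tau>': "\<tau> i \<in> carrier G" "\<tau> i \<notin> generate G (\<tau> ` {..<i})" if "i \<le> m - 1" for i
      using \<tau>(1) \<tau>(4)[of i] \<tau>(5)[of i] that by (auto simp: N_def)
    have "cayley_data G p f h 1 x y y z \<tau> (m - 1)"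
      by unfold_locales (use fin oddG p x y(1,2) zc f h vals zv z(3) \<tau>(2,3) \<tau>' m indep in \<open>auto simp: N_def\<close>)
    then show ?thesis by blast
  next
    case False
    then have roots: "\<exists>a\<in>carrier G. y = a [^] p" if "y \<in> carrier G" "y [^] p = \<one>" for y
      using that by blast
    have "\<exists>u\<in>carrier G. \<forall>a\<in>carrier G. u \<noteq> a [^] p"
    proof (rule ccontr)
      assume "\<not> (\<exists>u\<in>carrier G. \<forall>a\<in>carrier G. u \<noteq> a [^] p)"
      then have all: "\<exists>a\<in>carrier G. g = a [^] p" if "g \<in> carrier G" for g using that by blast
      \<comment> \<open>If every element were a p-th power, the cyclicity criterion would apply with
        \<one> as generator.\<close>
      have "\<exists>(i::nat). \<exists>a\<in>carrier G. g = \<one> [^] i \<otimes> a [^] p" if g: "g \<in> carrier G" for g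
        using all[OF g] by auto
      then show False using cyclic_if_generated_mod_powers[OF ord one_closed] nc by blast
    qed
    then obtain u where u: "u \<in> carrier G" "\<And>a. a \<in> carrier G \<Longrightarrow> u \<noteq> a [^] p" by blast
    have "u \<noteq> \<one>" using u(2)[of \<one>] by auto
    then obtain j :: nat where j: "u [^] j \<noteq> \<one>" "(u [^] j) [^] p = \<one>"
      using exists_power_of_order_prime[OF ord u(1)] by blast
    define z where "z = u [^] j"
    have z: "z \<in> carrier G" "z \<noteq> \<one>" "z [^] p = \<one>" using u j by (auto simp: z_def)
    \<comment> \<open>Otherwise g^p = \<one> has only the at most p powers of z as solutions, and G
      is cyclic.\<close>
    have "\<exists>y\<in>carrier G. y [^] p = \<one> \<and> (\<forall>k::nat. y \<noteq> z [^] k)"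
    proof (rule ccontr)
      assume "\<not> (\<exists>y\<in>carrier G. y [^] p = \<one> \<and> (\<forall>k::nat. y \<noteq> z [^] k))"
      then have all: "\<exists>k::nat. y = z [^] k" if "y \<in> carrier G" "y [^] p = \<one>" for y using that by blast
      have "{g \<in> carrier G. g [^] p = \<one>} \<subseteq> (\<lambda>k::nat. z [^] k) ` {..<p}"
      proof
        fix g assume "g \<in> {g \<in> carrier G. g [^] p = \<one>}"
        then obtain k :: nat where "g = z [^] k" using all by blast
        also have "z [^] k = z [^] (k mod p)" by (rule pow_cong_exponent[OF z(1,3)]) (simp add: cong_def)
        finally show "g \<in> (\<lambda>k::nat. z [^] k) ` {..<p}" using p0 by auto
      qed
      then have "card {g \<in> carrier G. g [^] p = \<one>} \<le> card {..<p}" by (rule surj_card_le[rotated]) simp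
      then show False using cyclic_if_few_roots[OF fin p(1) ord n] nc by simp
    qed
    then obtain y where y: "y \<in> carrier G" "y [^] p = \<one>" "\<And>k::nat. y \<noteq> z [^] k" by blast
    obtain x and f h :: "'a \<Rightarrow> nat" where x: "x \<in> carrier G"
      and f: "functional_mod p f" and h: "functional_mod p h"
      and vals: "f x = 1" "f u = 0" "h x = 0" "h u = 1"
      and powers: "\<forall>a\<in>carrier G. f (a [^] p) = 0 \<and> h (a [^] p) = 0"
      by (rule independent_functionals[OF fin p(1) ord nc u])
    have yz: "f y = 0" "h y = 0" "f z = 0" "h z = 0"
      using roots[OF y(1,2)] roots[OF z(1,3)] powers by auto
    define N where "N = {a \<in> carrier G. f a = 0 \<and> h a = 0}"
    have N: "subgroup N G"
      by (rule subgroupI)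
         (auto simp: N_def functional_mod_mult[OF f] functional_mod_mult[OF h] functional_mod_one[OF f p0] functional_mod_one[OF h p0]
           functional_mod_inv[OF f p0] functional_mod_inv[OF h p0])
    have yzN: "y \<in> N" "z \<in> N" using yz y z by (auto simp: N_def)
    have indep: "p dvd k" if eq: "y [^] k = z [^] l" for k l :: nat
    proof (rule ccontr)
      assume "\<not> p dvd k"
      then obtain i q where iq: "k * i = 1 + p * q" using prime_not_dvd_inverse p(1) by blast
      have "(y [^] k) [^] i = y \<otimes> (y [^] p) [^] q"
        using y(1) by (simp add: nat_pow_pow iq nat_pow_mult[symmetric] m_comm)
      then have "y = (z [^] l) [^] i" using eq y by simp
      then have "y = z [^] (l * i)" using z by (simp add: nat_pow_pow)
      then show False using y(3) by blast
    qed
    have indep2: "p dvd k \<and> z [^] l = z [^] l'" if eq: "y [^] k \<otimes> z [^] l = z [^] l'" for k l l' :: nat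
    proof -
      have "(p - 1) * l + l = p * l" using p1 by (cases p) auto
      then have "z [^] l \<otimes> z [^] ((p - 1) * l) = (z [^] p) [^] l"
        using z(1) by (simp only: nat_pow_mult nat_pow_pow add.commute)
      then have cancel: "z [^] l \<otimes> z [^] ((p - 1) * l) = \<one>" using z by simp
      have "y [^] k = (y [^] k \<otimes> z [^] l) \<otimes> z [^] ((p - 1) * l)"
        using y z cancel by (simp add: m_assoc)
      also have "\<dots> = z [^] (l' + (p - 1) * l)" unfolding eq using z by (simp add: nat_pow_mult)
      finally have pk: "p dvd k" by (rule indep)
      then have "y [^] k = \<one>" by (rule pow_dvd_exponent[OF y(1,2)])
      then show ?thesis using pk eq z by simp
    qed
    \<comment> \<open>This is y z^(-1). The chain begins with z, t and not with z, y, because no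
      member may be a power of y or of y z. Still z and t generate y and y z, so every later member
      avoids their powers automatically.\<close>
    define t where "t = y \<otimes> z [^] (p - 1)"
    have tz: "t \<otimes> z = y"
    proof -
      have "z [^] (p - 1) \<otimes> z = z [^] p" using p0 by (cases p) auto
      then show ?thesis using y z by (simp add: t_def m_assoc)
    qed
    have tN: "t \<in> N"
      unfolding t_def by (rule subgroup.m_closed[OF N yzN(1) subgroup_nat_pow_closed[OF N yzN(2)]])
    have t_new: "t \<notin> generate G {z}"
    proof
      assume "t \<in> generate G {z}"
      then have "t \<otimes> z \<in> generate G {z}" by (rule generate.eng) (auto intro: generate.incl)
      then obtain k :: int where "y = z [^] k" using tz generate_pow[OF z(1)] by auto
      moreover have "z [^] k = z [^] nat (k mod int p)"
      proof -
        have "z [^] k = z [^] (int p * (k div int p) + k mod int p)" by simp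
        also have "\<dots> = (z [^] int p) [^] (k div int p) \<otimes> z [^] (k mod int p)"
          using z(1) by (simp only: int_pow_mult int_pow_pow)
        also have "\<dots> = z [^] (k mod int p)" using z by (simp add: int_pow_int)
        also have "\<dots> = z [^] int (nat (k mod int p))" using p0 by simp
        finally show ?thesis by (simp add: int_pow_int)
      qed
      ultimately show False using y(3) by simp
    qed
    define \<tau>0 where "\<tau>0 i = (if i = 0 then z else t)" for i :: nat
    have "\<exists>\<sigma> (m::nat). 2 \<le> m \<and> (\<forall>i<2. \<sigma> i = \<tau>0 i) \<and> generate G (\<sigma> ` {..<m}) = N \<and>
      (\<forall>i<m. \<sigma> i \<in> N \<and> \<sigma> i \<notin> generate G (\<sigma> ` {..<i}))"
    proof (rule exists_generating_chain[where \<tau> = \<tau>0 and k = 2, OF fin N])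
      fix i :: nat assume "i < 2"
      then consider "i = 0" | "i = 1" by linarith
      then show "\<tau>0 i \<in> N \<and> \<tau>0 i \<notin> generate G (\<tau>0 ` {..<i})"
        by cases (use z yzN tN t_new in \<open>auto simp: \<tau>0_def generate_empty lessThan_Suc\<close>)
    qed
    then obtain \<tau> and m :: nat where chain: "2 \<le> m" "\<forall>i<2. \<tau> i = \<tau>0 i" "generate G (\<tau> ` {..<m}) = N"
      "\<forall>i<m. \<tau> i \<in> N \<and> \<tau> i \<notin> generate G (\<tau> ` {..<i})" by blast
    then have \<tau>: "2 \<le> m" "\<tau> 0 = z" "\<tau> 1 = t" "generate G (\<tau> ` {..<m}) = N" "\<And>i. i < m \<Longrightarrow> \<tau> i \<in> N"
      "\<And>i. i < m \<Longrightarrow> \<tau> i \<notin> generate G (\<tau> ` {..<i})" by (simp_all add: \<tau>0_def)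
    have m: "{..m - 1} = {..<m}" using \<tau>(1) by auto
    have avoid_z: "z \<noteq> y [^] k \<and> z \<noteq> (y \<otimes> z) [^] k" for k :: nat
    proof (intro conjI notI)
      assume "z = y [^] k"
      then have "y [^] k \<otimes> z [^] (0::nat) = z [^] (1::nat)" using z y by simp
      then show False using indep2[of k 0 1] z by simp
    next
      assume "z = (y \<otimes> z) [^] k"
      then have "y [^] k \<otimes> z [^] k = z [^] (1::nat)" using z y by (simp add: nat_pow_distrib)
      from indep2[OF this] have "p dvd k" "z [^] k = z" using z by auto
      then show False using pow_dvd_exponent[OF z(1,3)] z(2) by simp
    qed
    have avoid_t: "t \<noteq> y [^] k \<and> t \<noteq> (y \<otimes> z) [^] k" for k :: nat
    proof -
      have "(p - 1) + 1 = p" using p0 by simp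
      then have yy: "y [^] (p - 1) \<otimes> y = \<one>" using y by (metis nat_pow_Suc Suc_eq_plus1)
      have key: "y [^] (p - 1) \<otimes> t = z [^] (p - 1)"
        using yy y z by (simp add: t_def m_assoc[symmetric])
      show ?thesis
      proof (intro conjI notI)
        assume t: "t = y [^] k"
        have "y [^] (p - 1 + k) \<otimes> z [^] (0::nat) = z [^] (p - 1)"
          using key y(1) z(1) unfolding t by (simp add: nat_pow_mult)
        from indep2[OF this] have "z [^] (p - 1) = \<one>" using z by simp
        moreover have "\<not> p dvd p - 1" using p1 by (simp add: nat_dvd_not_less)
        ultimately show False using z_root[of z "p - 1"] z by blast
      next
        \<comment> \<open>As a power of y z, the element y z^(-1) would need an exponent congruent
          to both 1 and -1, impossible modulo an odd prime.\<close>
        assume t: "t = (y \<otimes> z) [^] k"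
        have "y [^] (p - 1 + k) \<otimes> z [^] k = y [^] (p - 1) \<otimes> t"
          unfolding t using y z by (simp add: nat_pow_distrib nat_pow_mult[symmetric] m_assoc)
        then have "y [^] (p - 1 + k) \<otimes> z [^] k = z [^] (p - 1)" using key by simp
        from indep2[OF this] have d: "p dvd p - 1 + k" and zk: "z [^] k = z [^] (p - 1)" by auto
        have "z [^] (2 * (p - 1)) = z [^] (p - 1 + k)" using zk z by (simp add: mult_2 nat_pow_mult[symmetric])
        also have "\<dots> = \<one>" by (rule pow_dvd_exponent[OF z(1,3) d])
        finally have "z [^] (2 * (p - 1)) = \<one>" .
        moreover have "\<not> p dvd 2 * (p - 1)"
        proof
          assume "p dvd 2 * (p - 1)"
          moreover have "coprime p 2" using p by simp
          ultimately have "p dvd p - 1" using coprime_dvd_mult_right_iff by blast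
          then show False using p1 by (simp add: nat_dvd_not_less)
        qed
        ultimately show False using z_root[of z "2 * (p - 1)"] z by blast
      qed
    qed
    have avoid: "\<tau> i \<noteq> y [^] k \<and> \<tau> i \<noteq> (y \<otimes> z) [^] k" if i: "i \<le> m - 1" for i and k :: nat
    proof -
      have im: "i < m" using i \<tau>(1) by linarith
      consider "i = 0" | "i = 1" | "2 \<le> i" by linarith
      then show ?thesis
      proof cases
        case 1
        then show ?thesis using avoid_z \<tau>(2) by simp
      next
        case 2
        then show ?thesis using avoid_t \<tau>(3) by simp
      next
        case 3
        let ?F = "generate G (\<tau> ` {..<i})"
        have sub: "subgroup ?F G" using \<tau>(5) im by (intro generate_is_subgroup) (auto simp: N_def)
        have "\<tau> 0 \<in> ?F" "\<tau> 1 \<in> ?F" using 3 by (intro generate.incl imageI; simp)+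
        then have "z \<in> ?F" "t \<in> ?F" using \<tau>(2,3) by simp_all
        then have "y \<in> ?F" "y \<otimes> z \<in> ?F" using tz subgroup.m_closed[OF sub] by metis+
        then have "y [^] k \<in> ?F" "(y \<otimes> z) [^] k \<in> ?F" using subgroup_nat_pow_closed[OF sub] by blast+
        then show ?thesis using \<tau>(6)[OF im] by metis
      qed
    qed
    have \<tau>': "\<tau> i \<in> carrier G" "\<tau> i \<notin> generate G (\<tau> ` {..<i})" if "i \<le> m - 1" for i
      using \<tau>(1) \<tau>(5)[of i] \<tau>(6)[of i] that by (auto simp: N_def)
    have "cayley_data G p f h 0 x u y z \<tau> (m - 1)"
      by unfold_locales
        (use fin oddG p x y(1,2) u(1) z(1,3) f h vals yz \<tau>(2,4) \<tau>' m avoid indep in \<open>auto simp: N_def\<close>)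
    then show ?thesis by blast
  qed
qed

theorem theorem1p1:
  fixes p n :: nat and G :: "('a, 'b) monoid_scheme"
  assumes "prime p" and "odd p"
    and "comm_group G" and "finite (carrier G)" and "order G = p ^ n"
    and "order G \<ge> p ^ 3"
    and "\<not> cyclic_group G"
  shows "\<exists>S. S \<subseteq> carrier G \<and> \<one>\<^bsub>G\<^esub> \<notin> S \<and>
           proper_digraph (Cay G S) \<and>
           Cayley_index G S = p \<and>
           (\<exists>R. regular_subgroup R (Cay G S) \<and>
                \<not> comm_group ((Aut_digraph (Cay G S))\<lparr>carrier := R\<rparr>))"
proof -
  interpret comm_group G by fact
  obtain f h e x u y z \<tau> m where "cayley_data G p f h e x u y z \<tau> m"
    using exists_cayley_data[OF assms(4,1,2,5,6,7)] by blast
  then interpret cayley_data G p f h e x u y z \<tau> m .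
  show ?thesis using S_witness by blast
qed

end
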